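(* Let $G$ be an ascending HNN-extension of the Heisenberg group. Then $G$ is transitive self-similar.
   Context: The Heisenberg group is $N=\langle x, y \mid [x,y] = z, [z,x] = 1 = [z,y] \rangle$. An ascending HNN-extension of $N$ is a group of the form $\langle N, t \mid t g t^{-1} = \varphi(g) \text{ for } g \in N\rangle$, where $\varphi : N \to N$ is an injective homomorphism (possibly surjective). Transitive self-similar: for an integer $m\ge 2$ let $\mathcal{T}_m$ be the rooted tree in which every vertex has exactly $m$ descendants (children). Each automorphism $g$ of $\mathcal{T}_m$ can be written as $g = (g_0,\dots,g_{m-1})\sigma$, where $\sigma\in S_m$ is the permutation induced by $g$ on the first level and $g_0,\dots,g_{m-1} \in \mathrm{Aut}(\mathcal{T}_m)$ (the states of $g$) describe the action of $g$ on the $m$ subtrees rooted at the first-level vertices, each such subtree being identified with $\mathcal{T}_m$ in the standard way. A group $G$ is self-similar if for some $m$ it has a faithful action on $\mathcal{T}_m$ by automorphisms such that, viewing $G \le \mathrm{Aut}(\mathcal{T}_m)$, all states $g_0,\dots,g_{m-1}$ of every $g\in G$ belong to $G$. It is transitive self-similar if such an action can be chosen to be transitive on the first level of $\mathcal{T}_m$. *)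

theory Defs
  imports "HOL-Algebra.Algebra"
begin

section \<open>Groups given by presentations\<close>

text \<open>
  A letter is a generator together with a sign: \<open>(a, True)\<close> stands for \<open>a\<close> and \<open>(a, False)\<close>
  for its inverse.  The relations of a presentation are pairs of words \<open>(r, s)\<close>, read \<open>r = s\<close>.
\<close>

type_synonym 'a gword = "('a \<times> bool) list"

definition gwords :: "'a set \<Rightarrow> 'a gword set" where
  "gwords S = lists (S \<times> UNIV)"

definition gword_inv :: "'a gword \<Rightarrow> 'a gword" where
  "gword_inv w = rev (map (\<lambda>(a, e). (a, \<not> e)) w)"

definition gword_commutator :: "'a gword \<Rightarrow> 'a gword \<Rightarrow> 'a gword" where
  "gword_commutator u v = u @ v @ gword_inv u @ gword_inv v"

inductive gword_eq :: "'a set \<Rightarrow> ('a gword \<times> 'a gword) set \<Rightarrow> 'a gword \<Rightarrow> 'a gword \<Rightarrow> bool"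
  for S :: "'a set" and R :: "('a gword \<times> 'a gword) set" where
  refl: "w \<in> gwords S \<Longrightarrow> gword_eq S R w w"
| sym: "gword_eq S R u v \<Longrightarrow> gword_eq S R v u"
| trans: "gword_eq S R u v \<Longrightarrow> gword_eq S R v w \<Longrightarrow> gword_eq S R u w"
| cancel: "u \<in> gwords S \<Longrightarrow> v \<in> gwords S \<Longrightarrow> a \<in> S \<Longrightarrow>
    gword_eq S R (u @ [(a, e), (a, \<not> e)] @ v) (u @ v)"
| relation: "u \<in> gwords S \<Longrightarrow> v \<in> gwords S \<Longrightarrow> (r, s) \<in> R \<Longrightarrow>
    r \<in> gwords S \<Longrightarrow> s \<in> gwords S \<Longrightarrow> gword_eq S R (u @ r @ v) (u @ s @ v)"

definition gword_class :: "'a set \<Rightarrow> ('a gword \<times> 'a gword) set \<Rightarrow> 'a gword \<Rightarrow> 'a gword set" where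
  "gword_class S R w = {v. gword_eq S R w v}"

definition presented_group ::
    "'a set \<Rightarrow> ('a gword \<times> 'a gword) set \<Rightarrow> 'a gword set monoid" where
  "presented_group S R =
    \<lparr>carrier = gword_class S R ` gwords S,
     monoid.mult = (\<lambda>A B. \<Union>u\<in>A. \<Union>v\<in>B. gword_class S R (u @ v)),
     monoid.one = gword_class S R []\<rparr>"

lemma gword_eq_in_gwords: "gword_eq S R u v \<Longrightarrow> u \<in> gwords S \<and> v \<in> gwords S"
  by (induction rule: gword_eq.induct) (auto simp: gwords_def)

lemma gword_eq_append_left: "gword_eq S R u v \<Longrightarrow> w \<in> gwords S \<Longrightarrow> gword_eq S R (w @ u) (w @ v)"
proof (induction rule: gword_eq.induct)
  case (refl x)
  then show ?case by (intro gword_eq.refl) (auto simp: gwords_def)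
next
  case (cancel x y a e)
  then show ?case using gword_eq.cancel[of "w @ x" S y a R e] by (auto simp: gwords_def)
next
  case (relation x y r s)
  then show ?case using gword_eq.relation[of "w @ x" S y r s R] by (auto simp: gwords_def)
next
  case (sym u v)
  then show ?case by (simp add: gword_eq.sym)
next
  case (trans u v w)
  then show ?case using gword_eq.trans by simp blast
qed

lemma gword_eq_append_right: "gword_eq S R u v \<Longrightarrow> w \<in> gwords S \<Longrightarrow> gword_eq S R (u @ w) (v @ w)"
proof (induction rule: gword_eq.induct)
  case (refl x)
  then show ?case by (intro gword_eq.refl) (auto simp: gwords_def)
next
  case (cancel x y a e)
  then show ?case using gword_eq.cancel[of x S "y @ w" a R e] by (auto simp: gwords_def)
next
  case (relation x y r s)
  then show ?case using gword_eq.relation[of x S "y @ w" r s R] by (auto simp: gwords_def)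
next
  case (sym u v)
  then show ?case by (simp add: gword_eq.sym)
next
  case (trans u v w)
  then show ?case using gword_eq.trans by simp blast
qed

lemma gword_class_eq_iff:
  "u \<in> gwords S \<Longrightarrow> gword_class S R u = gword_class S R v \<longleftrightarrow> gword_eq S R u v"
  unfolding gword_class_def
  by (metis (mono_tags, lifting) Collect_cong gword_eq.refl gword_eq.sym gword_eq.trans
      mem_Collect_eq)

lemma presented_group_mult:
  assumes "u \<in> gwords S" "v \<in> gwords S"
  shows "gword_class S R u \<otimes>\<^bsub>presented_group S R\<^esub> gword_class S R v = gword_class S R (u @ v)"
proof -
  have eq: "gword_class S R (u' @ v') = gword_class S R (u @ v)"
    if u': "u' \<in> gword_class S R u" and v': "v' \<in> gword_class S R v" for u' v'
  proof -
    have "gword_eq S R u u'" "gword_eq S R v v'"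
      using u' v' by (simp_all add: gword_class_def)
    then have "gword_eq S R (u @ v) (u' @ v)" "gword_eq S R (u' @ v) (u' @ v')"
      using assms gword_eq_in_gwords[of S R u u']
      by (simp_all add: gword_eq_append_left gword_eq_append_right)
    then have "gword_eq S R (u @ v) (u' @ v')" by (rule gword_eq.trans)
    moreover have "u @ v \<in> gwords S" using assms by (auto simp: gwords_def)
    ultimately show ?thesis using gword_class_eq_iff by metis
  qed
  have mem: "u \<in> gword_class S R u" "v \<in> gword_class S R v"
    using assms by (auto simp: gword_class_def intro: gword_eq.refl)
  have inner: "(\<Union>v'\<in>gword_class S R v. gword_class S R (u' @ v')) = gword_class S R (u @ v)"
    if "u' \<in> gword_class S R u" for u'
    by (rule SUP_eq_const) (use mem(2) in blast, rule eq[OF that])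
  have "(\<Union>u'\<in>gword_class S R u. \<Union>v'\<in>gword_class S R v. gword_class S R (u' @ v'))
      = gword_class S R (u @ v)"
    by (rule SUP_eq_const) (use mem(1) in blast, rule inner)
  then show ?thesis by (simp add: presented_group_def)
qed

lemma gword_inv_left: "w \<in> gwords S \<Longrightarrow> gword_eq S R (gword_inv w @ w) []"
proof (induction w)
  case Nil
  then show ?case by (auto simp: gword_inv_def gwords_def intro: gword_eq.refl)
next
  case (Cons x w)
  obtain a e where x: "x = (a, e)" by force
  have w: "w \<in> gwords S" "a \<in> S" "gword_inv w \<in> gwords S"
    using Cons.prems x by (auto simp: gwords_def gword_inv_def split: prod.splits)
  have "gword_eq S R (gword_inv w @ [(a, \<not> e), (a, \<not> \<not> e)] @ w) (gword_inv w @ w)"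
    using w by (intro gword_eq.cancel)
  then show ?case
    using Cons.IH[OF w(1)] x by (auto simp: gword_inv_def intro: gword_eq.trans)
qed

lemma group_presented_group: "group (presented_group S R)"
proof (rule groupI)
  let ?G = "presented_group S R"
  have carrier: "carrier ?G = gword_class S R ` gwords S"
    by (simp add: presented_group_def)
  have one: "\<one>\<^bsub>?G\<^esub> = gword_class S R []"
    by (simp add: presented_group_def)
  have nil: "[] \<in> gwords S" by (simp add: gwords_def)
  have app: "u @ v \<in> gwords S" if "u \<in> gwords S" "v \<in> gwords S" for u v
    using that by (auto simp: gwords_def)
  show "\<one>\<^bsub>?G\<^esub> \<in> carrier ?G" using carrier one nil by auto
  show "x \<otimes>\<^bsub>?G\<^esub> y \<in> carrier ?G" if "x \<in> carrier ?G" "y \<in> carrier ?G" for x y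
    using that app by (auto simp: carrier presented_group_mult)
  show "x \<otimes>\<^bsub>?G\<^esub> y \<otimes>\<^bsub>?G\<^esub> z = x \<otimes>\<^bsub>?G\<^esub> (y \<otimes>\<^bsub>?G\<^esub> z)"
    if "x \<in> carrier ?G" "y \<in> carrier ?G" "z \<in> carrier ?G" for x y z
    using that app by (auto simp: carrier presented_group_mult)
  show "\<one>\<^bsub>?G\<^esub> \<otimes>\<^bsub>?G\<^esub> x = x" if "x \<in> carrier ?G" for x
    using that nil by (auto simp: carrier one presented_group_mult)
  show "\<exists>y\<in>carrier ?G. y \<otimes>\<^bsub>?G\<^esub> x = \<one>\<^bsub>?G\<^esub>" if "x \<in> carrier ?G" for x
  proof -
    obtain w where w: "x = gword_class S R w" "w \<in> gwords S"
      using \<open>x \<in> carrier ?G\<close> carrier by auto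
    have inv: "gword_inv w \<in> gwords S"
      using w(2) by (auto simp: gwords_def gword_inv_def)
    have "gword_class S R (gword_inv w) \<otimes>\<^bsub>?G\<^esub> x = \<one>\<^bsub>?G\<^esub>"
      using w inv app gword_inv_left[OF w(2)] by (simp add: presented_group_mult one gword_class_eq_iff)
    then show ?thesis using inv carrier by blast
  qed
qed


section \<open>The Heisenberg group and ascending HNN-extensions\<close>

datatype heisenberg_gen = Gen_x | Gen_y

definition heisenberg :: "heisenberg_gen gword set monoid" where
  "heisenberg =
    (let x = [(Gen_x, True)]; y = [(Gen_y, True)]; z = gword_commutator x y
     in presented_group {Gen_x, Gen_y}
          {(gword_commutator z x, []), (gword_commutator z y, [])})"

text \<open>
  The presentation \<open>\<langle>N, t | t g t\<^sup>-\<^sup>1 = \<phi>(g) for g \<in> N\<rangle>\<close>: the generators are the elements \<open>Some g\<close>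
  of \<open>N\<close> and the stable letter \<open>None\<close>, and writing \<open>N\<close> in the presentation stands for imposing
  the multiplication table of \<open>N\<close>.
\<close>

definition hnn_group :: "('a, 'b) monoid_scheme \<Rightarrow> ('a \<Rightarrow> 'a) \<Rightarrow> 'a option gword set monoid" where
  "hnn_group N \<phi> =
    presented_group (insert None (Some ` carrier N))
      ({([(Some g, True), (Some h, True)], [(Some (g \<otimes>\<^bsub>N\<^esub> h), True)]) | g h.
          g \<in> carrier N \<and> h \<in> carrier N}
       \<union> {([(None, True), (Some g, True), (None, False)], [(Some (\<phi> g), True)]) | g.
          g \<in> carrier N})"

definition ascending_HNN_extension ::
    "('a, 'b) monoid_scheme \<Rightarrow> ('c, 'd) monoid_scheme \<Rightarrow> bool" where
  "ascending_HNN_extension N G \<longleftrightarrow>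
    group G \<and> (\<exists>\<phi>. \<phi> \<in> hom N N \<and> inj_on \<phi> (carrier N) \<and> G \<cong> hnn_group N \<phi>)"


section \<open>Self-similar actions on the rooted tree in which each vertex has m children\<close>

text \<open>
  The vertices are the words over \<open>{0, \<dots>, m - 1}\<close>, the root is the empty word, and the children
  of \<open>v\<close> are the words \<open>v @ [i]\<close>.  The subtree rooted at the first-level vertex \<open>[i]\<close> consists of
  the words \<open>i # w\<close>, and \<open>i # w \<mapsto> w\<close> is its standard identification with the whole tree.
\<close>

definition tree_vertices :: "nat \<Rightarrow> nat list set" where
  "tree_vertices m = lists {..<m}"

definition child_of :: "nat list \<Rightarrow> nat list \<Rightarrow> bool" where
  "child_of w v \<longleftrightarrow> (\<exists>i. w = v @ [i])"

definition tree_automorphisms :: "nat \<Rightarrow> (nat list \<Rightarrow> nat list) set" where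
  "tree_automorphisms m =
    {g \<in> Bij (tree_vertices m). g [] = [] \<and>
      (\<forall>v \<in> tree_vertices m. \<forall>w \<in> tree_vertices m. child_of (g w) (g v) \<longleftrightarrow> child_of w v)}"

definition tree_state :: "nat \<Rightarrow> (nat list \<Rightarrow> nat list) \<Rightarrow> nat \<Rightarrow> nat list \<Rightarrow> nat list" where
  "tree_state m g i = (\<lambda>w \<in> tree_vertices m. tl (g (i # w)))"

text \<open>The decomposition \<open>g = (g\<^sub>0, \<dots>, g\<^sub>m\<^sub>-\<^sub>1)\<sigma>\<close>, with \<open>g [i] = [\<sigma> i]\<close>:\<close>

lemma tree_state_decomposition:
  assumes g: "g \<in> tree_automorphisms m" and i: "i < m" and "w \<in> tree_vertices m"
  shows "\<exists>j<m. g [i] = [j] \<and> g (i # w) = j # tree_state m g i w"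
proof -
  have V: "g v \<in> tree_vertices m" if "v \<in> tree_vertices m" for v
    using g that by (auto simp: tree_automorphisms_def Bij_def bij_betw_def)
  have child: "child_of (g w) (g v)"
    if "v \<in> tree_vertices m" "w \<in> tree_vertices m" "child_of w v" for v w
    using g that by (auto simp: tree_automorphisms_def)
  have "child_of (g [i]) (g [])"
    using i by (intro child) (auto simp: tree_vertices_def child_of_def)
  moreover have "g [] = []" using g by (auto simp: tree_automorphisms_def)
  ultimately obtain j where j: "g [i] = [j]" by (auto simp: child_of_def)
  have "j < m" using V[of "[i]"] i j by (auto simp: tree_vertices_def)
  have "\<exists>u. g (i # w) = j # u"
    using \<open>w \<in> tree_vertices m\<close>
  proof (induction w rule: rev_induct)
    case (snoc k w)
    then have "child_of (g (i # w @ [k])) (g (i # w))"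
      using i by (intro child) (auto simp: tree_vertices_def child_of_def)
    moreover have "\<exists>u. g (i # w) = j # u"
      using snoc by (auto simp: tree_vertices_def)
    ultimately show ?case by (auto simp: child_of_def)
  qed (simp add: j)
  then show ?thesis
    using \<open>j < m\<close> j \<open>w \<in> tree_vertices m\<close> by (auto simp: tree_state_def)
qed

definition self_similar_action ::
    "('a, 'b) monoid_scheme \<Rightarrow> nat \<Rightarrow> ('a \<Rightarrow> nat list \<Rightarrow> nat list) \<Rightarrow> bool" where
  "self_similar_action G m \<rho> \<longleftrightarrow>
    faithful_action G (tree_vertices m) \<rho> \<and>
    (\<forall>g \<in> carrier G. \<rho> g \<in> tree_automorphisms m) \<and>
    (\<forall>g \<in> carrier G. \<forall>i<m. tree_state m (\<rho> g) i \<in> \<rho> ` carrier G)"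

definition transitive_self_similar :: "('a, 'b) monoid_scheme \<Rightarrow> bool" where
  "transitive_self_similar G \<longleftrightarrow>
    (\<exists>m \<ge> 2. \<exists>\<rho>. self_similar_action G m \<rho> \<and>
      (\<forall>i<m. \<forall>j<m. \<exists>g \<in> carrier G. \<rho> g [i] = [j]))"

end

theory Submission
  imports Defs
begin

text \<open>
  A homomorphism \<open>f: H \<rightarrow> G\<close> from a subgroup of finite index \<open>m\<close> makes \<open>G\<close> act on the \<open>m\<close>-ary tree, with
  states given by \<open>f\<close> and a coset transversal; the kernel is a normal \<open>f\<close>-invariant subgroup inside \<open>H\<close>.
  An ascending HNN-extension of the Heisenberg group \<open>N\<close> is \<open>N\<^sub>\<infinity> \<rtimes> \<int>\<close>, where \<open>N\<^sub>\<infinity>\<close> is the union of the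
  \<open>\<phi>\<^sup>-\<^sup>i(N)\<close> in the rational Heisenberg group. Suppose \<open>D\<close> is an automorphism of the latter such that
  \<open>D \<phi>\<^sup>n = \<phi> D\<close> and \<open>D\<close> multiplies the centre by \<open>1/\<beta>\<close>, with \<open>\<beta>\<close> coprime to \<open>det \<phi>\<close>. Then
  \<open>(v, ni) \<mapsto> (D v, i)\<close> is a virtual endomorphism. An invariant normal subgroup meets the centre in infinitely
  \<open>\<beta>\<close>-divisible elements, hence trivially, and by taking commutators it meets \<open>N\<^sub>\<infinity>\<close> trivially. For \<open>n \<ge> 2\<close> its
  \<open>\<int>\<close>-components are infinitely \<open>n\<close>-divisible; for \<open>n = 1\<close> it centralises \<open>N\<^sub>\<infinity>\<close>, which is excluded
  when no power of \<open>\<phi>\<close> is trivial on \<open>N\<close> modulo its centre. A suitable \<open>D\<close> is found by cases on the eigenvalues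
  of \<open>\<phi>\<close> on the abelianisation.
\<close>


section \<open>Virtual endomorphisms\<close>

text \<open>The colouring \<open>\<kappa>\<close> is injective on representatives of distinct
  cosets, so every finite set of cosets has at most \<open>card B\<close> elements. It may depend on
  \<open>S\<close>, only \<open>B\<close> being fixed: below, elements can be reduced to lattice
  points only finitely many at a time.\<close>

lemma (in group) finite_rcong_quotientI:
  assumes H: "subgroup H G"
    and C: "\<And>S. finite S \<Longrightarrow> S \<subseteq> carrier G \<Longrightarrow>
      \<exists>\<kappa>::'a \<Rightarrow> 'c. \<kappa> ` S \<subseteq> B \<and> (\<forall>x\<in>S. \<forall>y\<in>S. \<kappa> x = \<kappa> y \<longrightarrow> inv x \<otimes> y \<in> H)"
    and B: "finite B"
  shows "finite (carrier G // rcong H)"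
proof -
  have eq: "equiv (carrier G) (rcong H)" using H by (rule subgroup.equiv_rcong) (rule is_group)
  have "card Q \<le> card B" if Q: "Q \<subseteq> carrier G // rcong H" "finite Q" for Q
  proof -
    define p where "p U = (SOME x. x \<in> U)" for U :: "'a set"
    have p: "p U \<in> U" if "U \<in> Q" for U
      using that Q(1) in_quotient_imp_non_empty[OF eq] unfolding p_def by (metis ex_in_conv someI_ex subsetD)
    have sub: "p ` Q \<subseteq> carrier G"
      using p Q(1) in_quotient_imp_subset[OF eq] by blast
    obtain \<kappa> :: "'a \<Rightarrow> 'c" where \<kappa>: "\<kappa> ` p ` Q \<subseteq> B"
      "\<forall>x\<in>p ` Q. \<forall>y\<in>p ` Q. \<kappa> x = \<kappa> y \<longrightarrow> inv x \<otimes> y \<in> H"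
      using C[OF finite_imageI[OF Q(2)] sub] by blast
    have "inj_on (\<kappa> \<circ> p) Q"
    proof (rule inj_onI)
      fix U V assume UV: "U \<in> Q" "V \<in> Q" "(\<kappa> \<circ> p) U = (\<kappa> \<circ> p) V"
      then have "inv (p U) \<otimes> p V \<in> H" using \<kappa>(2) by simp
      then have "(p U, p V) \<in> rcong H"
        using UV sub by (auto simp: r_congruent_def)
      then show "U = V" using quotient_eqI[OF eq] UV Q(1) p by blast
    qed
    then show ?thesis
      using card_inj_on_le[of "\<kappa> \<circ> p" Q B] \<kappa>(1) B by (auto simp: image_image)
  qed
  then show ?thesis using finite_if_finite_subsets_card_bdd by blast
qed

section \<open>The tree action given by a virtual endomorphism and a coset transversal\<close>

locale transversal = group G for G (structure) +
  fixes H :: "'a set" and f :: "'a \<Rightarrow> 'a" and m :: nat and r :: "nat \<Rightarrow> 'a"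
  assumes H: "subgroup H G"
    and f: "f \<in> hom (G\<lparr>carrier := H\<rparr>) G"
    and r: "i < m \<Longrightarrow> r i \<in> carrier G"
    and ex1: "g \<in> carrier G \<Longrightarrow> \<exists>!i. i < m \<and> inv (r i) \<otimes> g \<in> H"
begin

definition idx :: "'a \<Rightarrow> nat" where
  "idx g = (THE i. i < m \<and> inv (r i) \<otimes> g \<in> H)"

lemma idx:
  assumes "g \<in> carrier G" shows "idx g < m" "inv (r (idx g)) \<otimes> g \<in> H"
  using theI'[OF ex1[OF assms]] unfolding idx_def by auto

lemma idx_eqI: "g \<in> carrier G \<Longrightarrow> i < m \<Longrightarrow> inv (r i) \<otimes> g \<in> H \<Longrightarrow> idx g = i"
  using ex1 idx by blast

lemma idx_r: "i < m \<Longrightarrow> idx (r i) = i"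
  using r H by (intro idx_eqI) (auto simp: subgroup.one_closed)

lemma idx_mult:
  assumes "g \<in> carrier G" "h \<in> H" shows "idx (g \<otimes> h) = idx g"
proof (rule idx_eqI)
  have h: "h \<in> carrier G" using assms H subgroup.mem_carrier by metis
  then show "g \<otimes> h \<in> carrier G" using assms by simp
  show "idx g < m" using idx assms by simp
  have "inv (r (idx g)) \<otimes> (g \<otimes> h) = inv (r (idx g)) \<otimes> g \<otimes> h"
    using assms h idx[of g] r by (simp add: m_assoc)
  then show "inv (r (idx g)) \<otimes> (g \<otimes> h) \<in> H"
    using assms idx[of g] H by (simp add: subgroup.m_closed)
qed

text \<open>The Schreier cocycle: \<open>g \<otimes> r i = r j \<otimes> st g i\<close>, where
  \<open>j\<close> is the index of the left coset of \<open>g \<otimes> r i\<close>.\<close>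

definition st :: "'a \<Rightarrow> nat \<Rightarrow> 'a" where
  "st g i = inv (r (idx (g \<otimes> r i))) \<otimes> (g \<otimes> r i)"

lemma st_H: "g \<in> carrier G \<Longrightarrow> i < m \<Longrightarrow> st g i \<in> H"
  unfolding st_def using idx r by simp

lemma f_closed: "h \<in> H \<Longrightarrow> f h \<in> carrier G"
  using f by (auto simp: hom_def)

lemma f_mult: "h \<in> H \<Longrightarrow> k \<in> H \<Longrightarrow> f (h \<otimes> k) = f h \<otimes> f k"
  using f by (auto simp: hom_def)

lemma f_one: "f \<one> = \<one>"
proof -
  have "\<one> \<in> H" using H by (rule subgroup.one_closed)
  then have "f \<one> \<otimes> f \<one> = f \<one>" "f \<one> \<in> carrier G"
    using f_mult[of \<one> \<one>] f_closed by auto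
  then show ?thesis by simp
qed

lemma f_inv: "h \<in> H \<Longrightarrow> f (inv h) = inv (f h)"
proof -
  assume h: "h \<in> H"
  then have "inv h \<in> H" "h \<in> carrier G" using H
    by (auto simp: subgroup.m_inv_closed subgroup.mem_carrier)
  then have "f (inv h) \<otimes> f h = \<one>" using f_mult[of "inv h" h] h f_one by simp
  then show ?thesis using f_closed h \<open>inv h \<in> H\<close> by (metis inv_equality)
qed

lemma g_r: "g \<in> carrier G \<Longrightarrow> i < m \<Longrightarrow> g \<otimes> r i = r (idx (g \<otimes> r i)) \<otimes> st g i"
  unfolding st_def using r idx[of "g \<otimes> r i"] by (simp add: m_assoc[symmetric])

text \<open>The representative of \<open>h \<otimes> r i\<close> is split off first, then that of
  \<open>g\<close> times it; the remaining factor from \<open>H\<close> stands on the right and does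
  not change the coset. This cocycle rule is what makes \<open>act\<close> multiplicative.\<close>

lemma idx_st_mult:
  assumes "g \<in> carrier G" "h \<in> carrier G" "i < m"
  shows "idx (g \<otimes> h \<otimes> r i) = idx (g \<otimes> r (idx (h \<otimes> r i)))"
    and "st (g \<otimes> h) i = st g (idx (h \<otimes> r i)) \<otimes> st h i"
proof -
  let ?j = "idx (h \<otimes> r i)"
  have j: "?j < m" "r ?j \<in> carrier G" "r i \<in> carrier G" using assms idx r by auto
  have s: "st h i \<in> H" "st h i \<in> carrier G"
    using st_H assms H by (auto simp: subgroup.mem_carrier)
  have "g \<otimes> h \<otimes> r i = g \<otimes> r ?j \<otimes> st h i"
    using g_r[of h i] assms j s by (simp add: m_assoc)
  moreover have "idx (g \<otimes> r ?j \<otimes> st h i) = idx (g \<otimes> r ?j)"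
    using assms j s by (intro idx_mult) auto
  ultimately show 1: "idx (g \<otimes> h \<otimes> r i) = idx (g \<otimes> r ?j)" by simp
  have "r (idx (g \<otimes> r ?j)) \<in> carrier G" using assms j r idx by auto
  then show "st (g \<otimes> h) i = st g ?j \<otimes> st h i"
    unfolding st_def[of "g \<otimes> h"] 1 using \<open>g \<otimes> h \<otimes> r i = g \<otimes> r ?j \<otimes> st h i\<close> assms j s
    by (simp add: st_def[of g] m_assoc)
qed

lemma idx_st_one:
  assumes "i < m" shows "idx (\<one> \<otimes> r i) = i" "st \<one> i = \<one>"
  using assms r by (auto simp: idx_r st_def)

text \<open>The first letter moves as left multiplication permutes the left cosets; the remaining
  letters are moved by the \<open>f\<close>-image of the cocycle, so that the states of
  \<open>g\<close> come from elements of \<open>G\<close>.\<close>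

fun act :: "'a \<Rightarrow> nat list \<Rightarrow> nat list" where
  "act g [] = []"
| "act g (i # w) = idx (g \<otimes> r i) # act (f (st g i)) w"

lemma act_closed: "g \<in> carrier G \<Longrightarrow> w \<in> tree_vertices m \<Longrightarrow> act g w \<in> tree_vertices m"
  by (induction w arbitrary: g) (auto simp: tree_vertices_def idx r st_H f_closed)

lemma act_mult:
  "g \<in> carrier G \<Longrightarrow> h \<in> carrier G \<Longrightarrow> w \<in> tree_vertices m \<Longrightarrow> act (g \<otimes> h) w = act g (act h w)"
proof (induction w arbitrary: g h)
  case (Cons i w)
  then show ?case
    by (auto simp: tree_vertices_def idx_st_mult f_mult st_H idx r f_closed)
qed simp

lemma act_one: "w \<in> tree_vertices m \<Longrightarrow> act \<one> w = w"
proof (induction w)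
  case (Cons i w)
  then have "i < m" by (simp add: tree_vertices_def)
  with Cons show ?case by (simp only: act.simps idx_st_one f_one) (simp add: tree_vertices_def)
qed simp

lemma act_snoc: "\<exists>j. act g (v @ [i]) = act g v @ [j]"
  by (induction v arbitrary: g) auto

lemma child_act: "child_of w v \<Longrightarrow> child_of (act g w) (act g v)"
  using act_snoc by (auto simp: child_of_def)

definition \<rho> :: "'a \<Rightarrow> nat list \<Rightarrow> nat list" where
  "\<rho> g = restrict (act g) (tree_vertices m)"

lemma act_inv:
  assumes "g \<in> carrier G" "w \<in> tree_vertices m"
  shows "act (inv g) (act g w) = w" "act g (act (inv g) w) = w"
  using assms act_mult[of "inv g" g w] act_mult[of g "inv g" w] act_one by auto

lemma act_bij: "g \<in> carrier G \<Longrightarrow> bij_betw (act g) (tree_vertices m) (tree_vertices m)"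
  by (rule bij_betw_byWitness[where f' = "act (inv g)"]) (auto simp: act_inv act_closed)

lemma \<rho>_Bij: "g \<in> carrier G \<Longrightarrow> \<rho> g \<in> Bij (tree_vertices m)"
  by (simp add: Bij_def \<rho>_def act_bij bij_betw_restrict_eq)

lemma \<rho>_tree_automorphisms:
  assumes g: "g \<in> carrier G" shows "\<rho> g \<in> tree_automorphisms m"
proof -
  have "child_of (act g w) (act g v) \<longleftrightarrow> child_of w v"
    if "v \<in> tree_vertices m" "w \<in> tree_vertices m" for v w
    using child_act[of w v g] child_act[of "act g w" "act g v" "inv g"] act_inv[OF g] that by auto
  moreover have "[] \<in> tree_vertices m" by (simp add: tree_vertices_def)
  ultimately show ?thesis
    unfolding tree_automorphisms_def using \<rho>_Bij[OF g] by (simp add: \<rho>_def)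
qed

lemma \<rho>_hom: "\<rho> \<in> hom G (BijGroup (tree_vertices m))"
proof (rule homI)
  fix g h assume gh: "g \<in> carrier G" "h \<in> carrier G"
  show "\<rho> (g \<otimes> h) = \<rho> g \<otimes>\<^bsub>BijGroup (tree_vertices m)\<^esub> \<rho> h"
    using gh by (auto simp: BijGroup_def \<rho>_Bij compose_def \<rho>_def act_mult act_closed restrict_def fun_eq_iff)
      (metis \<rho>_Bij[unfolded \<rho>_def restrict_def])+
qed (simp add: BijGroup_def \<rho>_Bij)

lemma \<rho>_state:
  assumes "g \<in> carrier G" "i < m"
  shows "tree_state m (\<rho> g) i = \<rho> (f (st g i))"
  using assms by (auto simp: tree_state_def \<rho>_def tree_vertices_def restrict_def)

lemma \<rho>_transitive:
  assumes "i < m" "j < m"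
  shows "\<exists>g \<in> carrier G. \<rho> g [i] = [j]"
proof
  show "r j \<otimes> inv (r i) \<in> carrier G" using assms r by simp
  have "r j \<otimes> inv (r i) \<otimes> r i = r j" using assms r by (simp add: m_assoc)
  then show "\<rho> (r j \<otimes> inv (r i)) [i] = [j]"
    using assms by (simp add: \<rho>_def tree_vertices_def idx_r)
qed

section \<open>The kernel of the tree action\<close>

definition kern :: "'a set" where
  "kern = {g \<in> carrier G. \<forall>w\<in>tree_vertices m. act g w = w}"

lemma kern_conj:
  assumes "k \<in> kern" "g \<in> carrier G" shows "g \<otimes> k \<otimes> inv g \<in> kern"
  using assms by (auto simp: kern_def act_mult act_closed act_inv)

lemma kern_normal: "kern \<lhd> G"
  unfolding normal_inv_iff
proof
  show "subgroup kern G"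
  proof (rule subgroupI)
    show "kern \<noteq> {}" using act_one by (auto simp: kern_def)
    show "inv g \<in> kern" if "g \<in> kern" for g
      using that act_inv(1)[of g] by (auto simp: kern_def)
  qed (auto simp: kern_def act_mult)
qed (use kern_conj in blast)

lemma kern_state:
  assumes "k \<in> kern" "i < m"
  shows "idx (k \<otimes> r i) = i" "f (st k i) \<in> kern"
proof -
  have eq: "act k (i # w) = i # w" if "w \<in> tree_vertices m" for w
  proof -
    have "i # w \<in> tree_vertices m" using that assms(2) by (simp add: tree_vertices_def)
    then show ?thesis using assms(1) by (simp add: kern_def del: act.simps)
  qed
  from eq[of "[]"] show "idx (k \<otimes> r i) = i" by (simp add: tree_vertices_def)
  show "f (st k i) \<in> kern"
    using eq assms f_closed st_H by (auto simp: kern_def)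
qed

text \<open>The representative of the coset \<open>H\<close> need not be \<open>\<one>\<close>, but
  it lies in \<open>H\<close>. The cocycle of \<open>k\<close> at that coset is the conjugate of
  \<open>k\<close> by this representative, so \<open>k\<close> is in \<open>H\<close>, and
  \<open>f k\<close> is conjugate to a state of \<open>k\<close>, which is in the normal subgroup
  \<open>kern\<close>.\<close>

lemma kern_core: "kern \<subseteq> H" "f ` kern \<subseteq> kern"
proof -
  let ?i = "idx \<one>" and ?h = "r (idx \<one>)"
  have i: "?i < m" using idx by simp
  then have hc: "?h \<in> carrier G" using r by simp
  have "inv ?h \<in> H" using idx(2)[of \<one>] hc by simp
  then have h: "?h \<in> H" using H hc by (metis inv_inv subgroup.m_inv_closed)
  have *: "k \<in> H \<and> f k \<in> kern" if k: "k \<in> kern" for k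
  proof -
    have kc: "k \<in> carrier G" using k by (simp add: kern_def)
    let ?s = "st k ?i"
    have s: "?s = inv ?h \<otimes> k \<otimes> ?h" "?s \<in> H" "f ?s \<in> kern"
      using kern_state[OF k i] st_H[OF kc i] kc hc by (auto simp: st_def m_assoc)
    have k_eq: "k = ?h \<otimes> ?s \<otimes> inv ?h"
      using hc kc s by (simp add: m_assoc inv_solve_left inv_solve_right')
         (simp add: m_assoc[symmetric])
    then have "k \<in> H" using h s \<open>inv ?h \<in> H\<close> H
      by (metis subgroup.m_closed)
    moreover have "f k = f ?h \<otimes> f ?s \<otimes> inv (f ?h)"
      by (subst k_eq) (use h s \<open>inv ?h \<in> H\<close> H in \<open>simp add: f_mult f_inv subgroup.m_closed\<close>)
    ultimately show ?thesis using kern_conj s f_closed h by simp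
  qed
  show "kern \<subseteq> H" "f ` kern \<subseteq> kern" using * by auto
qed

end

text \<open>The first level of the tree is the coset space, whence transitivity; the action is
  faithful because its kernel is one of the subgroups \<open>K\<close> that \<open>simple\<close>
  makes trivial.\<close>

theorem (in group) transitive_self_similar_virtual_endomorphism:
  assumes H: "subgroup H G" and fin: "finite (carrier G // rcong H)"
    and f: "f \<in> hom (G\<lparr>carrier := H\<rparr>) G"
    and simple: "\<And>K. K \<lhd> G \<Longrightarrow> K \<subseteq> H \<Longrightarrow> f ` K \<subseteq> K \<Longrightarrow> K = {\<one>}"
    and nontriv: "carrier G \<noteq> {\<one>}"
  shows "transitive_self_similar G"
proof -
  let ?Q = "carrier G // rcong H"
  define m where "m = card ?Q"
  have eq: "equiv (carrier G) (rcong H)" using H by (rule subgroup.equiv_rcong) (rule is_group)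
  obtain e where e: "bij_betw e {..<m} ?Q"
    using ex_bij_betw_nat_finite[OF fin] by (auto simp: m_def atLeast0LessThan)
  define r where "r i = (SOME x. x \<in> e i)" for i
  have eQ: "e i \<in> ?Q" if "i < m" for i using e that by (auto simp: bij_betw_def)
  have r: "r i \<in> e i" if "i < m" for i
    using in_quotient_imp_non_empty[OF eq eQ[OF that]] unfolding r_def by (metis ex_in_conv someI_ex)
  have rc: "r i \<in> carrier G" if "i < m" for i
    using r[OF that] in_quotient_imp_subset[OF eq eQ[OF that]] by blast
  have iff: "inv (r i) \<otimes> g \<in> H \<longleftrightarrow> g \<in> e i" if "i < m" "g \<in> carrier G" for i g
  proof -
    have "g \<in> e i \<longleftrightarrow> (r i, g) \<in> rcong H"
      using in_quotient_imp_closed[OF eq eQ[OF that(1)] r[OF that(1)]]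
        quotient_eq_iff[OF eq eQ[OF that(1)] eQ[OF that(1)] r[OF that(1)]] by blast
    then show ?thesis using that rc by (auto simp: r_congruent_def)
  qed
  interpret transversal G H f m r
  proof (intro transversal.intro transversal_axioms.intro is_group H f rc)
    fix g assume g: "g \<in> carrier G"
    have "\<exists>!i. i < m \<and> g \<in> e i"
    proof -
      obtain U where U: "U \<in> ?Q" "g \<in> U" using Union_quotient[OF eq] g by blast
      moreover have "U = V" if "V \<in> ?Q" "g \<in> V" for V
        using quotient_disj[OF eq U(1) that(1)] U(2) that(2) by blast
      moreover obtain i where "i < m" "e i = U"
        using e U(1) unfolding bij_betw_def by (metis imageE lessThan_iff)
      moreover have "i = j" if "i < m" "j < m" "e i = e j" for i j
        using e that by (auto simp: bij_betw_def inj_on_def)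
      ultimately show ?thesis using eQ by metis
    qed
    then show "\<exists>!i. i < m \<and> inv (r i) \<otimes> g \<in> H" using iff g by metis
  qed
  \<comment> \<open>At index 1 the whole group would be a normal \<open>f\<close>-invariant subgroup
    inside \<open>H\<close>, hence trivial by \<open>simple\<close>.\<close>
  have "m \<ge> 2"
  proof (rule ccontr)
    assume "\<not> m \<ge> 2"
    then have "carrier G \<subseteq> H"
    proof -
      have "idx g = 0" if "g \<in> carrier G" for g using idx(1)[OF that] \<open>\<not> m \<ge> 2\<close> by simp
      then have *: "inv (r 0) \<otimes> g \<in> H" if "g \<in> carrier G" for g using idx(2)[OF that] that by simp
      have r0: "r 0 \<in> carrier G" using idx(1)[of \<one>] rc by (metis gr0I not_less_zero one_closed)
      show ?thesis
      proof
        fix g assume "g \<in> carrier G"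
        then show "g \<in> H" using *[of "r 0 \<otimes> g"] r0 by (simp add: m_assoc[symmetric])
      qed
    qed
    then have "carrier G = {\<one>}" using f_closed by (intro simple normal_self) auto
    then show False using nontriv by simp
  qed
  moreover have "inj_on \<rho> (carrier G)"
  proof (rule inj_onI)
    fix g h assume gh: "g \<in> carrier G" "h \<in> carrier G" "\<rho> g = \<rho> h"
    have "act (inv h \<otimes> g) w = w" if w: "w \<in> tree_vertices m" for w
    proof -
      have "act g w = act h w" using gh(3) w unfolding \<rho>_def by (metis restrict_apply')
      then show ?thesis using gh w act_mult act_inv by simp
    qed
    then have "inv h \<otimes> g \<in> kern" using gh by (simp add: kern_def)
    then have "inv h \<otimes> g = \<one>"
      using simple[OF kern_normal kern_core] by simp
    then show "g = h" using gh by (metis inv_closed inv_equality inv_inv)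
  qed
  moreover have "group_action G (tree_vertices m) \<rho>"
    unfolding group_action_def group_hom_def group_hom_axioms_def
    using \<rho>_hom group_BijGroup is_group by blast
  ultimately show ?thesis
    unfolding transitive_self_similar_def self_similar_action_def faithful_action_def
      faithful_action_axioms_def
    using \<rho>_tree_automorphisms \<rho>_state f_closed st_H \<rho>_transitive
    by (intro exI[of _ m] conjI exI[of _ \<rho>]) auto
qed

text \<open>The action is pulled back along \<open>h\<close>. The set of tree automorphisms
  occurring stays the same, so it still contains the states.\<close>

lemma transitive_self_similar_iso:
  assumes "group G" "h \<in> iso G K" "transitive_self_similar K"
  shows "transitive_self_similar G"
proof -
  obtain m \<rho> where m: "m \<ge> 2" "self_similar_action K m \<rho>"
    "\<forall>i<m. \<forall>j<m. \<exists>g \<in> carrier K. \<rho> g [i] = [j]"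
    using assms(3) by (auto simp: transitive_self_similar_def)
  have h: "h \<in> hom G K" "bij_betw h (carrier G) (carrier K)" using assms(2) by (auto simp: iso_def)
  then have im: "h ` carrier G = carrier K" "inj_on h (carrier G)" by (auto simp: bij_betw_def)
  have K: "\<rho> \<in> hom K (BijGroup (tree_vertices m))" "inj_on \<rho> (carrier K)"
    using m(2) by (auto simp: self_similar_action_def faithful_action_def faithful_action_axioms_def
      group_action_def group_hom_def group_hom_axioms_def)
  have "\<rho> \<circ> h \<in> hom G (BijGroup (tree_vertices m))" using h(1) K(1) by (rule hom_compose)
  then have "faithful_action G (tree_vertices m) (\<rho> \<circ> h)"
    unfolding faithful_action_def faithful_action_axioms_def group_action_def group_hom_def
      group_hom_axioms_def using assms(1) group_BijGroup K(2) im by (auto intro: comp_inj_on)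
  moreover have "(\<rho> \<circ> h) ` carrier G = \<rho> ` carrier K" by (metis im(1) image_comp)
  moreover have "\<forall>i<m. \<forall>j<m. \<exists>g \<in> carrier G. (\<rho> \<circ> h) g [i] = [j]"
    using m(3) im(1) by (metis comp_apply imageE)
  ultimately show ?thesis
    unfolding transitive_self_similar_def self_similar_action_def
    using m(1) m(2)[unfolded self_similar_action_def] im(1)
    by (intro exI[of _ m] conjI exI[of _ "\<rho> \<circ> h"]) (auto, (metis image_eqI)+)
qed

section \<open>The rational Heisenberg group\<close>

definition zpow :: "('a \<Rightarrow> 'a) \<Rightarrow> int \<Rightarrow> 'a \<Rightarrow> 'a" where
  "zpow f k = (if 0 \<le> k then f ^^ nat k else inv_into UNIV f ^^ nat (- k))"

lemma zpow_of_nat [simp]: "zpow f (int n) = f ^^ n"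
  by (simp add: zpow_def)

lemma zpow_0 [simp]: "zpow f 0 v = v"
  by (simp add: zpow_def)

lemma zpow_1 [simp]: "zpow f 1 = f"
  by (simp add: zpow_def)

lemma zpow_step:
  assumes "bij f" shows "zpow f (k + 1) v = f (zpow f k v)"
proof (cases "0 \<le> k")
  case True
  then show ?thesis by (simp add: zpow_def nat_add_distrib)
next
  case False
  then have "nat (- k) = Suc (nat (- (k + 1)))" by simp
  then show ?thesis using False assms
    by (auto simp: zpow_def bij_is_surj surj_f_inv_f)
qed

lemma zpow_add:
  assumes "bij f" shows "zpow f (j + k) v = zpow f j (zpow f k v)"
proof (induction j rule: int_induct[where k = 0])
  case (step1 i)
  then show ?case using zpow_step[OF assms, of "i + k"] zpow_step[OF assms, of i]
    by (simp add: algebra_simps)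
next
  case (step2 i)
  have "f (zpow f (i - 1 + k) v) = f (zpow f (i - 1) (zpow f k v))"
    using step2 zpow_step[OF assms, of "i - 1 + k"] zpow_step[OF assms, of "i - 1"]
    by (simp add: algebra_simps)
  then show ?case using assms by (simp add: bij_is_inj inj_eq)
qed simp

lemma zpow_neg_cancel:
  assumes "bij f"
  shows "zpow f (- k) (zpow f k v) = v" "zpow f k (zpow f (- k) v) = v"
  using zpow_add[OF assms, of "- k" k v] zpow_add[OF assms, of k "- k" v] by simp_all

lemma zpow_hom:
  assumes "bij f" and f: "\<And>v w. f (g v w) = g (f v) (f w)"
  shows "zpow f k (g v w) = g (zpow f k v) (zpow f k w)"
proof (induction k rule: int_induct[where k = 0])
  case (step1 i)
  then show ?case by (simp add: zpow_step[OF assms(1)] f)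
next
  case (step2 i)
  have "f (zpow f (i - 1) u) = zpow f i u" for u
    using zpow_step[OF assms(1), of "i - 1"] by simp
  then have "f (zpow f (i - 1) (g v w)) = f (g (zpow f (i - 1) v) (zpow f (i - 1) w))"
    using step2 by (simp add: f)
  then show ?case by (rule injD[OF bij_is_inj[OF assms(1)]])
qed simp

text \<open>
  The rational Heisenberg group in exponential coordinates, with the central coordinate doubled.
  In these coordinates every endomorphism is linear, and \<open>x\<^sup>a y\<^sup>b z\<^sup>c\<close> is \<open>(a, b, ab + 2c)\<close>.
\<close>

type_synonym vec = "rat \<times> rat \<times> rat"

fun hmul :: "vec \<Rightarrow> vec \<Rightarrow> vec" where
  "hmul (a, b, c) (a', b', c') = (a + a', b + b', c + c' + a * b' - b * a')"

fun hinv :: "vec \<Rightarrow> vec" where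
  "hinv (a, b, c) = (- a, - b, - c)"

text \<open>The endomorphism sending x = (1, 0, 0) to (p, r, l) and y = (0, 1, 0) to (q, s, k);
  taking commutators forces the determinant as the factor on the centre.\<close>

fun hlin :: "rat \<Rightarrow> rat \<Rightarrow> rat \<Rightarrow> rat \<Rightarrow> rat \<Rightarrow> rat \<Rightarrow> vec \<Rightarrow> vec" where
  "hlin p q r s l k (a, b, c) = (p * a + q * b, r * a + s * b, (p * s - q * r) * c + l * a + k * b)"

text \<open>The parity condition selects the integral points (a, b, ab + 2c), so this is the copy of
  the integral Heisenberg group.\<close>

definition heis_lattice :: "vec set" where
  "heis_lattice = {(of_int a, of_int b, of_int c) | a b c. even (c - a * b)}"

lemma hmul_assoc: "hmul (hmul u v) w = hmul u (hmul v w)"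
  by (cases u; cases v; cases w) (simp add: algebra_simps)

lemma hmul_0 [simp]: "hmul (0, 0, 0) v = v" "hmul v (0, 0, 0) = v"
  by (cases v; simp)+

lemma hmul_hinv [simp]: "hmul (hinv v) v = (0, 0, 0)" "hmul v (hinv v) = (0, 0, 0)"
  by (cases v; simp)+

lemma hmul_hinv_cancel [simp]: "hmul (hinv v) (hmul v w) = w" "hmul v (hmul (hinv v) w) = w"
  by (simp_all add: hmul_assoc[symmetric])

lemma hinv_unique: "hmul v w = (0, 0, 0) \<Longrightarrow> w = hinv v"
  by (metis hmul_0(2) hmul_hinv_cancel(1))

lemma hlin_hmul: "hlin p q r s l k (hmul v w) = hmul (hlin p q r s l k v) (hlin p q r s l k w)"
  by (cases v; cases w) (simp add: algebra_simps)

lemma hlin_hinv: "hlin p q r s l k (hinv v) = hinv (hlin p q r s l k v)"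
  by (cases v) (simp add: algebra_simps)

lemma bij_hlin:
  assumes "p * s - q * r \<noteq> 0" shows "bij (hlin p q r s l k)"
\<comment> \<open>On the abelianisation the witness is the inverse matrix, of determinant
  \<open>1 / d\<close>; its central row is the row (l, k) times that inverse matrix, times
  \<open>- 1 / d\<close>.\<close>
proof (rule bij_betw_byWitness[where f' =
      "let d = p * s - q * r in hlin (s / d) (- q / d) (- r / d) (p / d)
        (- (l * s - k * r) / d\<^sup>2) ((l * q - k * p) / d\<^sup>2)"])
  define d where "d = p * s - q * r"
  have d: "d \<noteq> 0" using assms by (simp add: d_def)
  have det: "s / d * (p / d) - - q / d * (- r / d) = 1 / d"
    using d by (simp add: field_simps) (simp add: d_def algebra_simps)
  let ?g = "hlin (s / d) (- q / d) (- r / d) (p / d)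
        (- (l * s - k * r) / d\<^sup>2) ((l * q - k * p) / d\<^sup>2)"
  have "?g (hlin p q r s l k v) = v" for v
  proof -
    obtain a b c where v: "v = (a, b, c)" by (cases v)
    have 1: "s / d * (p * a + q * b) + - q / d * (r * a + s * b) = a"
      "- r / d * (p * a + q * b) + p / d * (r * a + s * b) = b"
      using d by (simp_all add: field_simps) (simp_all add: d_def algebra_simps)
    have "1 / d * (d * c + l * a + k * b)
      + - (l * s - k * r) / d\<^sup>2 * (p * a + q * b) + (l * q - k * p) / d\<^sup>2 * (r * a + s * b) = c"
      using d by (simp add: field_simps power2_eq_square) (simp add: d_def algebra_simps)
    then show ?thesis unfolding v hlin.simps det 1 by (simp add: d_def)
  qed
  moreover have "hlin p q r s l k (?g v) = v" for v
  proof -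
    obtain a b c where v: "v = (a, b, c)" by (cases v)
    have 1: "p * (s / d * a + - q / d * b) + q * (- r / d * a + p / d * b) = a"
      "r * (s / d * a + - q / d * b) + s * (- r / d * a + p / d * b) = b"
      using d by (simp_all add: field_simps) (simp_all add: d_def algebra_simps)
    have "d * (1 / d * c + - (l * s - k * r) / d\<^sup>2 * a + (l * q - k * p) / d\<^sup>2 * b)
      + l * (s / d * a + - q / d * b) + k * (- r / d * a + p / d * b) = c"
      using d by (simp add: field_simps power2_eq_square)
    then show ?thesis unfolding v hlin.simps det 1 by (simp add: d_def)
  qed
  ultimately show "\<forall>v\<in>UNIV. (let d = p * s - q * r in hlin (s / d) (- q / d) (- r / d) (p / d)
        (- (l * s - k * r) / d\<^sup>2) ((l * q - k * p) / d\<^sup>2)) (hlin p q r s l k v) = v"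
    "\<forall>v\<in>UNIV. hlin p q r s l k ((let d = p * s - q * r in hlin (s / d) (- q / d) (- r / d) (p / d)
        (- (l * s - k * r) / d\<^sup>2) ((l * q - k * p) / d\<^sup>2)) v) = v"
    unfolding Let_def d_def by blast+
qed auto

lemma heis_latticeI: "even (c - a * b) \<Longrightarrow> (of_int a, of_int b, of_int c) \<in> heis_lattice"
  by (auto simp: heis_lattice_def)

lemma heis_latticeE:
  assumes "v \<in> heis_lattice"
  obtains a b c where "v = (of_int a, of_int b, of_int c)" "even (c - a * b)"
  using assms unfolding heis_lattice_def by blast

lemma heis_lattice_0: "(0, 0, 0) \<in> heis_lattice"
  using heis_latticeI[of 0 0 0] by simp

lemma heis_lattice_hmul:
  assumes "v \<in> heis_lattice" "w \<in> heis_lattice" shows "hmul v w \<in> heis_lattice"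
proof -
  obtain a b c a' b' c' where v: "v = (of_int a, of_int b, of_int c)" "even (c - a * b)"
    and w: "w = (of_int a', of_int b', of_int c')" "even (c' - a' * b')"
    using assms by (metis heis_latticeE)
  have 1: "hmul v w = (of_int (a + a'), of_int (b + b'), of_int (c + c' + a * b' - b * a'))"
    by (simp add: v w)
  have 2: "c + c' + a * b' - b * a' - (a + a') * (b + b')
    = (c - a * b) + (c' - a' * b') - 2 * (b * a')" by (simp add: algebra_simps)
  show ?thesis unfolding 1 by (rule heis_latticeI, unfold 2) (use v(2) w(2) in simp)
qed

lemma heis_lattice_hinv:
  assumes "v \<in> heis_lattice" shows "hinv v \<in> heis_lattice"
proof -
  obtain a b c where v: "v = (of_int a, of_int b, of_int c)" "even (c - a * b)"
    using assms by (metis heis_latticeE)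
  have "hinv v = (of_int (- a), of_int (- b), of_int (- c))" by (simp add: v)
  moreover have "even (- c - (- a) * (- b))" using v(2) by simp
  ultimately show ?thesis using heis_latticeI by metis
qed

declare hmul.simps [simp del] hinv.simps [simp del] hlin.simps [simp del]

section \<open>The ascending union of lattices and its extension by the integers\<close>

locale heis_model =
  fixes p q r s l k :: int
  assumes det: "p * s - q * r \<noteq> 0"
    and lattice: "v \<in> heis_lattice \<Longrightarrow>
      hlin (of_int p) (of_int q) (of_int r) (of_int s) (of_int l) (of_int k) v \<in> heis_lattice"
begin

definition \<phi> :: "vec \<Rightarrow> vec" where
  "\<phi> = hlin (of_int p) (of_int q) (of_int r) (of_int s) (of_int l) (of_int k)"

definition d :: int where "d = p * s - q * r"

lemma d0: "d \<noteq> 0" using det by (simp add: d_def)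

lemma bij_\<phi>: "bij \<phi>"
proof -
  have "of_int (p * s - q * r) \<noteq> (0::rat)" using det by linarith
  then show ?thesis unfolding \<phi>_def by (intro bij_hlin) simp
qed

lemmas zpow_\<phi>_add = zpow_add[OF bij_\<phi>]
lemmas zpow_\<phi>_cancel [simp] = zpow_neg_cancel[OF bij_\<phi>]

lemma \<phi>_hmul: "\<phi> (hmul v w) = hmul (\<phi> v) (\<phi> w)"
  by (simp add: \<phi>_def hlin_hmul)

lemma zpow_hmul: "zpow \<phi> j (hmul v w) = hmul (zpow \<phi> j v) (zpow \<phi> j w)"
  by (rule zpow_hom[where f = \<phi> and g = hmul, OF bij_\<phi> \<phi>_hmul])

lemma zpow_zero [simp]: "zpow \<phi> j (0, 0, 0) = (0, 0, 0)"
proof -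
  have "\<phi> (0, 0, 0) = (0, 0, 0)" by (simp add: \<phi>_def hlin.simps)
  \<comment> \<open>For a constant binary operation, \<open>zpow_hom\<close> says that a fixed point
    of \<open>\<phi>\<close> is fixed by all its powers.\<close>
  then show ?thesis using zpow_hom[OF bij_\<phi>, of "\<lambda>_ _. (0, 0, 0)"] by simp
qed

lemma zpow_hinv: "zpow \<phi> j (hinv v) = hinv (zpow \<phi> j v)"
  by (rule hinv_unique) (simp add: zpow_hmul[symmetric])

lemma funpow_lattice: "v \<in> heis_lattice \<Longrightarrow> (\<phi> ^^ i) v \<in> heis_lattice"
  by (induction i) (auto simp: \<phi>_def lattice)

definition Ninf :: "vec set" where
  "Ninf = {v. \<exists>i. (\<phi> ^^ i) v \<in> heis_lattice}"

lemma funpow_lattice_mono: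
  assumes "(\<phi> ^^ i) v \<in> heis_lattice" "i \<le> j" shows "(\<phi> ^^ j) v \<in> heis_lattice"
proof -
  have "\<phi> ^^ j = \<phi> ^^ (j - i) \<circ> \<phi> ^^ i" using assms(2) by (simp add: funpow_add[symmetric])
  then show ?thesis using funpow_lattice assms(1) by simp
qed

lemma lattice_Ninf: "v \<in> heis_lattice \<Longrightarrow> v \<in> Ninf"
  unfolding Ninf_def by (auto intro: exI[of _ 0])

lemma \<phi>_Ninf: "\<phi> v \<in> Ninf \<longleftrightarrow> v \<in> Ninf"
proof
  assume "\<phi> v \<in> Ninf"
  then obtain i where "(\<phi> ^^ i) (\<phi> v) \<in> heis_lattice" unfolding Ninf_def by blast
  then have "(\<phi> ^^ Suc i) v \<in> heis_lattice" by (simp add: funpow_swap1)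
  then show "v \<in> Ninf" unfolding Ninf_def by blast
next
  assume "v \<in> Ninf"
  then obtain i where "(\<phi> ^^ i) v \<in> heis_lattice" unfolding Ninf_def by blast
  then have "(\<phi> ^^ Suc i) v \<in> heis_lattice" using funpow_lattice_mono by (meson le_SucI order_refl)
  then have "(\<phi> ^^ i) (\<phi> v) \<in> heis_lattice" by (simp add: funpow_swap1)
  then show "\<phi> v \<in> Ninf" unfolding Ninf_def by blast
qed

lemma zpow_Ninf [simp]: "zpow \<phi> j v \<in> Ninf \<longleftrightarrow> v \<in> Ninf"
proof (induction j rule: int_induct[where k = 0])
  case (step1 i)
  have "zpow \<phi> (i + 1) v = \<phi> (zpow \<phi> i v)" by (rule zpow_step[OF bij_\<phi>])
  then show ?case using step1 by (simp only: \<phi>_Ninf)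
next
  case (step2 i)
  have "zpow \<phi> (i - 1 + 1) v = \<phi> (zpow \<phi> (i - 1) v)" by (rule zpow_step[OF bij_\<phi>])
  then show ?case using step2 by (simp only: \<phi>_Ninf diff_add_cancel)
qed simp

lemma zero_Ninf [simp]: "(0, 0, 0) \<in> Ninf"
  by (simp add: lattice_Ninf heis_lattice_0)

lemma hmul_Ninf: "v \<in> Ninf \<Longrightarrow> w \<in> Ninf \<Longrightarrow> hmul v w \<in> Ninf"
proof -
  assume "v \<in> Ninf" "w \<in> Ninf"
  then obtain i j where "(\<phi> ^^ i) v \<in> heis_lattice" "(\<phi> ^^ j) w \<in> heis_lattice"
    unfolding Ninf_def by blast
  then have "(\<phi> ^^ max i j) v \<in> heis_lattice" "(\<phi> ^^ max i j) w \<in> heis_lattice"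
    using funpow_lattice_mono by (meson max.cobounded1 max.cobounded2)+
  then have "(\<phi> ^^ max i j) (hmul v w) \<in> heis_lattice"
    using heis_lattice_hmul zpow_hmul[of "int (max i j)" v w] by (simp only: zpow_of_nat)
  then show "hmul v w \<in> Ninf" unfolding Ninf_def by blast
qed

lemma hinv_Ninf: "v \<in> Ninf \<Longrightarrow> hinv v \<in> Ninf"
  unfolding Ninf_def mem_Collect_eq using heis_lattice_hinv zpow_hinv[of "int _" v]
  unfolding zpow_of_nat by metis

text \<open>A semidirect product in which \<open>((0, 0, 0), 1)\<close> plays the stable letter:
  conjugation by it is \<open>\<phi>\<close> on \<open>Ninf\<close>.\<close>

definition Gc :: "(vec \<times> int) monoid" where
  "Gc = \<lparr>carrier = Ninf \<times> UNIV, monoid.mult = (\<lambda>(v, i) (w, j). (hmul v (zpow \<phi> i w), i + j)),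
     monoid.one = ((0, 0, 0), 0)\<rparr>"

lemma Gc_simps [simp]:
  "carrier Gc = Ninf \<times> UNIV"
  "(v, i) \<otimes>\<^bsub>Gc\<^esub> (w, j) = (hmul v (zpow \<phi> i w), i + j)"
  "\<one>\<^bsub>Gc\<^esub> = ((0, 0, 0), 0)"
  by (simp_all add: Gc_def)

lemma group_Gc: "group Gc"
proof (rule groupI)
  fix x assume "x \<in> carrier Gc"
  then obtain v i where x: "x = (v, i)" "v \<in> Ninf" by (metis Gc_simps(1) SigmaE)
  show "\<exists>y\<in>carrier Gc. y \<otimes>\<^bsub>Gc\<^esub> x = \<one>\<^bsub>Gc\<^esub>"
    using x hinv_Ninf
    by (intro bexI[of _ "(zpow \<phi> (- i) (hinv v), - i)"])
      (simp_all only: Gc_simps zpow_hinv hmul_hinv, simp_all add: hinv_Ninf[OF x(2)] flip: zpow_hinv)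
next
  fix x y z assume "x \<in> carrier Gc" "y \<in> carrier Gc" "z \<in> carrier Gc"
  then show "x \<otimes>\<^bsub>Gc\<^esub> y \<otimes>\<^bsub>Gc\<^esub> z = x \<otimes>\<^bsub>Gc\<^esub> (y \<otimes>\<^bsub>Gc\<^esub> z)"
    by (cases x; cases y; cases z) (simp only: Gc_simps zpow_hmul zpow_\<phi>_add hmul_assoc add.assoc)
next
  fix x y assume "x \<in> carrier Gc" "y \<in> carrier Gc"
  then show "x \<otimes>\<^bsub>Gc\<^esub> y \<in> carrier Gc"
    by (cases x; cases y) (simp add: hmul_Ninf)
next
  fix x show "\<one>\<^bsub>Gc\<^esub> \<otimes>\<^bsub>Gc\<^esub> x = x" by (cases x) simp
qed simp

sublocale Gc: group Gc by (rule group_Gc)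

lemma Gc_inv: "v \<in> Ninf \<Longrightarrow> inv\<^bsub>Gc\<^esub> (v, i) = (zpow \<phi> (- i) (hinv v), - i)"
proof (rule Gc.inv_equality)
  assume v: "v \<in> Ninf"
  show "(zpow \<phi> (- i) (hinv v), - i) \<otimes>\<^bsub>Gc\<^esub> (v, i) = \<one>\<^bsub>Gc\<^esub>"
    by (simp only: Gc_simps zpow_hinv hmul_hinv left_minus)
  show "(zpow \<phi> (- i) (hinv v), - i) \<in> carrier Gc"
    by (simp add: hinv_Ninf[OF v])
qed simp

text \<open>\<open>\<phi>\<close> multiplies the central coordinate by its determinant
  \<open>d\<close>, and lattice points are integral, so only powers of \<open>d\<close> occur as
  denominators.\<close>

lemma centre_Ninf:
  assumes "(0, 0, c) \<in> Ninf" shows "\<exists>i. of_int (d ^ i) * c \<in> \<int>"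
proof -
  have "(\<phi> ^^ i) (0, 0, c) = (0, 0, of_int (d ^ i) * c)" for i
  proof (induction i)
    case (Suc i)
    have "(\<phi> ^^ Suc i) (0, 0, c) = \<phi> ((\<phi> ^^ i) (0, 0, c))" by simp
    then show ?case unfolding Suc by (simp add: \<phi>_def d_def hlin.simps)
  qed simp
  then show ?thesis using assms unfolding Ninf_def mem_Collect_eq
    by (metis Ints_of_int heis_latticeE prod.inject)
qed

end

section \<open>Denominators and divisibility\<close>

lemma rat_fraction:
  fixes x :: rat
  obtains a b :: int where "x = of_int a / of_int b" "b > 0"
proof -
  obtain a b where "quotient_of x = (a, b)" by (cases "quotient_of x")
  then show thesis using that quotient_of_div[of x] quotient_of_denom_pos by blast
qed

text \<open>The numerators are made even so that points with such coordinates satisfy the parity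
  condition of \<open>heis_lattice\<close> automatically.\<close>

lemma even_common_denominator:
  fixes A :: "rat set" assumes "finite A"
  shows "\<exists>M::int. M > 0 \<and> (\<forall>x\<in>A. \<exists>j. of_int M * x = of_int (2 * j))"
  using assms
proof (induction A)
  case empty
  then show ?case by (intro exI[of _ 1]) simp
next
  case (insert x A)
  then obtain M where M: "M > 0" "\<forall>x\<in>A. \<exists>j. of_int M * x = of_int (2 * j)" by blast
  obtain a b where ab: "x = of_int a / of_int b" "b > 0"
    by (rule rat_fraction)
  have "\<exists>j. of_int (2 * M * b) * y = of_int (2 * j)" if "y \<in> insert x A" for y
  proof (cases "y = x")
    case True
    have "of_int (2 * M * b) * y = of_int (2 * (M * a))"
      unfolding True ab(1) using ab(2) by simp
    then show ?thesis by blast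
  next
    case False
    then have "y \<in> A" using that by simp
    then obtain j where j: "of_int M * y = of_int (2 * j)" using M(2) by fast
    have "of_int (2 * M * b) * y = of_int (2 * b) * (of_int M * y)" by simp
    also have "\<dots> = of_int (2 * (2 * b * j))" unfolding j by simp
    finally show ?thesis by blast
  qed
  moreover have "2 * M * b > 0" using M(1) ab(2) by simp
  ultimately show ?case by blast
qed

text \<open>After clearing denominators, every power of \<open>\<beta>\<close> divides a fixed
  multiple of the numerator of \<open>c\<close>, the other factor being a power of \<open>d\<close>
  coprime to it. Only the numerator 0 has so many divisors.\<close>

lemma coprime_power_denominator:
  fixes c :: rat and \<beta> d :: int
  assumes \<beta>: "\<bar>\<beta>\<bar> \<ge> 2" "coprime \<beta> d"
    and c: "\<And>j::nat. \<exists>i::nat. of_int (d ^ i) * (c / of_int (\<beta> ^ j)) \<in> \<int>"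
  shows "c = 0"
proof (rule ccontr)
  assume "c \<noteq> 0"
  obtain a b where ab: "c = of_int a / of_int b" "b > 0"
    by (rule rat_fraction)
  have a0: "a \<noteq> 0" using \<open>c \<noteq> 0\<close> ab by auto
  have "\<beta> ^ j dvd a" for j :: nat
  proof -
    obtain i :: nat and n where n: "of_int (d ^ i) * (c / of_int (\<beta> ^ j)) = of_int n"
      using c[of j] by (auto elim: Ints_cases)
    have "of_int (\<beta> ^ j) \<noteq> (0::rat)" "of_int b \<noteq> (0::rat)" using \<beta> ab by auto
    then have "rat_of_int (d ^ i * a) = of_int (n * b * \<beta> ^ j)"
      using n ab by (simp add: field_simps)
    then have "d ^ i * a = n * b * \<beta> ^ j" by (simp only: of_int_eq_iff)
    then have "\<beta> ^ j dvd d ^ i * a" by simp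
    then show ?thesis using \<beta>(2) by (simp add: coprime_dvd_mult_right_iff)
  qed
  \<comment> \<open>The exponent is taken to be the absolute value of \<open>a\<close> itself
    because \<open>2 ^ n\<close> exceeds \<open>n\<close>.\<close>
  then have "\<bar>\<beta> ^ nat \<bar>a\<bar>\<bar> \<le> \<bar>a\<bar>" using a0 by (meson dvd_imp_le_int)
  moreover have "2 ^ nat \<bar>a\<bar> \<le> \<bar>\<beta> ^ nat \<bar>a\<bar>\<bar>" using \<beta> by (simp add: power_abs power_mono)
  moreover have "int (nat \<bar>a\<bar>) < 2 ^ nat \<bar>a\<bar>" by (metis of_nat_less_two_power)
  ultimately show False by simp
qed

section \<open>Contracting virtual endomorphisms\<close>

text \<open>
  The last condition of \<open>alt\<close> says that no positive power of \<open>\<phi>\<close> acts trivially modulo the centre.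
\<close>

locale heis_contraction = heis_model +
  fixes P Q R S L K :: rat and \<beta> :: int and n :: nat
  assumes \<beta>: "\<bar>\<beta>\<bar> \<ge> 2" "coprime \<beta> d" "(P * S - Q * R) * of_int \<beta> = 1"
    and n: "n \<ge> 1"
    and comm: "hlin P Q R S L K ((\<phi> ^^ n) v) = \<phi> (hlin P Q R S L K v)"
    and alt: "n \<ge> 2 \<or> (\<forall>j>0. \<exists>v\<in>heis_lattice. \<forall>c. (\<phi> ^^ j) v \<noteq> (fst v, fst (snd v), c))"
begin

definition D :: "vec \<Rightarrow> vec" where "D = hlin P Q R S L K"

lemma D_hmul: "D (hmul v w) = hmul (D v) (D w)"
  by (simp add: D_def hlin_hmul)

lemma D_hinv: "D (hinv v) = hinv (D v)"
  by (simp add: D_def hlin_hinv)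

lemma D_0: "D (0, 0, 0) = (0, 0, 0)"
  by (simp add: D_def hlin.simps)

lemma D_zpow: "D (zpow \<phi> (int n * j) v) = zpow \<phi> j (D v)"
proof (induction j rule: int_induct[where k = 0])
  case (step1 i)
  have "zpow \<phi> (int n * (i + 1)) v = (\<phi> ^^ n) (zpow \<phi> (int n * i) v)"
    using zpow_\<phi>_add[of "int n" "int n * i" v] by (simp add: algebra_simps)
  then have "D (zpow \<phi> (int n * (i + 1)) v) = \<phi> (D (zpow \<phi> (int n * i) v))"
    by (simp add: D_def comm)
  then show ?case using step1 by (simp add: zpow_step[OF bij_\<phi>])
next
  case (step2 i)
  have "zpow \<phi> (int n * i) v = (\<phi> ^^ n) (zpow \<phi> (int n * (i - 1)) v)"
    using zpow_\<phi>_add[of "int n" "int n * (i - 1)" v] by (simp add: algebra_simps)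
  then have "\<phi> (D (zpow \<phi> (int n * (i - 1)) v)) = zpow \<phi> i (D v)"
    using step2 comm unfolding D_def by metis
  also have "\<dots> = \<phi> (zpow \<phi> (i - 1) (D v))"
    using zpow_step[OF bij_\<phi>, of "i - 1" "D v"] by simp
  finally show ?case by (rule injD[OF bij_is_inj[OF bij_\<phi>]])
qed simp

section \<open>The virtual endomorphism and the finite index of its domain\<close>

definition H :: "(vec \<times> int) set" where
  "H = {(v, i). v \<in> Ninf \<and> D v \<in> Ninf \<and> int n dvd i}"

definition F :: "vec \<times> int \<Rightarrow> vec \<times> int" where
  "F = (\<lambda>(v, i). (D v, i div int n))"

lemma H_iff: "(v, i) \<in> H \<longleftrightarrow> v \<in> Ninf \<and> D v \<in> Ninf \<and> int n dvd i"
  by (simp add: H_def)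

lemma F_simp: "F (v, i) = (D v, i div int n)"
  by (simp add: F_def)

lemma D_zpow_dvd: "int n dvd i \<Longrightarrow> D (zpow \<phi> i v) = zpow \<phi> (i div int n) (D v)"
  using n D_zpow[of "i div int n" v] by simp

lemma subgroup_H: "subgroup H Gc"
proof (rule Gc.subgroupI)
  show "H \<subseteq> carrier Gc" by (auto simp: H_def)
  have "((0, 0, 0), 0) \<in> H" by (simp add: H_iff D_0)
  then show "H \<noteq> {}" by blast
  fix x y assume "x \<in> H" "y \<in> H"
  then obtain v i w j where x: "x = (v, i)" "v \<in> Ninf" "D v \<in> Ninf" "int n dvd i"
    and y: "y = (w, j)" "w \<in> Ninf" "D w \<in> Ninf" "int n dvd j"
    unfolding H_def by blast
  show "x \<otimes>\<^bsub>Gc\<^esub> y \<in> H"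
    using x y by (simp add: H_iff hmul_Ninf D_hmul D_zpow_dvd)
  show "inv\<^bsub>Gc\<^esub> x \<in> H"
    using x by (simp add: Gc_inv H_iff hinv_Ninf D_hinv D_zpow_dvd)
qed

lemma F_hom: "F \<in> hom (Gc\<lparr>carrier := H\<rparr>) Gc"
proof (rule homI)
  fix x y assume "x \<in> carrier (Gc\<lparr>carrier := H\<rparr>)" "y \<in> carrier (Gc\<lparr>carrier := H\<rparr>)"
  then obtain v i w j where x: "x = (v, i)" "v \<in> Ninf" "D v \<in> Ninf" "int n dvd i"
    and y: "y = (w, j)" "w \<in> Ninf" "D w \<in> Ninf" "int n dvd j"
    unfolding H_def by auto
  then show "F x \<in> carrier Gc" by (simp add: F_simp)
  show "F (x \<otimes>\<^bsub>Gc\<lparr>carrier := H\<rparr>\<^esub> y) = F x \<otimes>\<^bsub>Gc\<^esub> F y"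
    using x y by (simp add: F_simp D_hmul D_zpow_dvd div_add)
qed

text \<open>This provides a congruence condition under which \<open>D\<close> takes values in the
  lattice; the index of \<open>H\<close> is bounded in terms of \<open>M\<close>.\<close>

lemma D_multiple: "\<exists>M::int. M > 0 \<and>
  (\<forall>a b c. D (of_int (M * a), of_int (M * b), of_int (M * c)) \<in> heis_lattice)"
proof -
  obtain M :: int where M: "M > 0" "\<forall>x\<in>{P, Q, R, S, P * S - Q * R, L, K}. \<exists>j. of_int M * x = of_int (2 * j)"
    using even_common_denominator[of "{P, Q, R, S, P * S - Q * R, L, K}"] by blast
  then obtain P' Q' R' S' E' L' K' where *: "of_int M * P = of_int (2 * P')"
    "of_int M * Q = of_int (2 * Q')" "of_int M * R = of_int (2 * R')" "of_int M * S = of_int (2 * S')"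
    "of_int M * (P * S - Q * R) = of_int (2 * E')" "of_int M * L = of_int (2 * L')"
    "of_int M * K = of_int (2 * K')" by (meson insertCI)
  have "D (of_int (M * a), of_int (M * b), of_int (M * c)) \<in> heis_lattice" for a b c
  proof -
    have "D (of_int (M * a), of_int (M * b), of_int (M * c))
      = ((of_int M * P) * of_int a + (of_int M * Q) * of_int b,
         (of_int M * R) * of_int a + (of_int M * S) * of_int b,
         (of_int M * (P * S - Q * R)) * of_int c + (of_int M * L) * of_int a + (of_int M * K) * of_int b)"
      by (simp add: D_def hlin.simps algebra_simps)
    also have "\<dots> = (of_int (2 * (P' * a + Q' * b)), of_int (2 * (R' * a + S' * b)),
      of_int (2 * (E' * c + L' * a + K' * b)))"
      unfolding * by (simp add: algebra_simps)
    also have "\<dots> \<in> heis_lattice" by (rule heis_latticeI) simp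
    finally show ?thesis .
  qed
  then show ?thesis using M(1) by blast
qed

text \<open>The group law adds \<open>b * x - a * y\<close>, again times \<open>M\<close>, to the
  central coordinate, so congruent coordinates give a quotient with coordinates divisible by
  \<open>M\<close>.\<close>

lemma lattice_cong:
  fixes M :: int
  assumes v: "v = (of_int a, of_int b, of_int c)" and w: "w = (of_int a', of_int b', of_int c')"
    and m: "a mod M = a' mod M" "b mod M = b' mod M" "c mod M = c' mod M"
  shows "\<exists>x y z. hmul (hinv v) w = (of_int (M * x), of_int (M * y), of_int (M * z))"
proof -
  obtain x where x: "a' - a = M * x" using m(1) by (metis mod_eq_dvd_iff dvdE)
  obtain y where y: "b' - b = M * y" using m(2) by (metis mod_eq_dvd_iff dvdE)
  obtain z where z: "c' - c = M * z" using m(3) by (metis mod_eq_dvd_iff dvdE)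
  have e: "a' = a + M * x" "b' = b + M * y" "c' = c + M * z" using x y z by simp_all
  have "hmul (hinv v) w = (of_int (M * x), of_int (M * y), of_int (M * (z - a * y + b * x)))"
    unfolding v w e by (simp add: hmul.simps hinv.simps algebra_simps)
  then show ?thesis by blast
qed

text \<open>Powers of \<open>\<phi>\<close> keep a point in the lattice once it is there, so a large
  exponent serves a finite set. It is a multiple of \<open>n\<close> because \<open>D\<close> can be
  moved past powers of \<open>\<phi> ^^ n\<close> only.\<close>

lemma uniform_lattice:
  assumes "finite W" "\<And>x. x \<in> W \<Longrightarrow> g x \<in> Ninf"
  shows "\<exists>J. \<forall>x\<in>W. (\<phi> ^^ (n * J)) (g x) \<in> heis_lattice"
proof -
  have "\<forall>\<^sub>F J in sequentially. \<forall>x\<in>W. (\<phi> ^^ (n * J)) (g x) \<in> heis_lattice"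
  proof (rule eventually_ball_finite[OF assms(1)], rule ballI)
    fix x assume "x \<in> W"
    then obtain i where i: "(\<phi> ^^ i) (g x) \<in> heis_lattice" using assms(2) unfolding Ninf_def by blast
    have "(\<phi> ^^ (n * J)) (g x) \<in> heis_lattice" if "i \<le> J" for J
    proof (rule funpow_lattice_mono[OF i])
      have "1 * J \<le> n * J" using n by (rule mult_le_mono1)
      then show "i \<le> n * J" using that by (simp only: mult_1)
    qed
    then show "\<forall>\<^sub>F J in sequentially. (\<phi> ^^ (n * J)) (g x) \<in> heis_lattice"
      unfolding eventually_sequentially by blast
  qed
  then show ?thesis unfolding eventually_sequentially by blast
qed

lemma finite_index: "finite (carrier Gc // rcong\<^bsub>Gc\<^esub> H)"
proof -
  obtain M :: int where M: "M > 0"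
    and DM: "\<And>a b c. D (of_int (M * a), of_int (M * b), of_int (M * c)) \<in> heis_lattice"
    using D_multiple by blast
  \<comment> \<open>The colour of an element is its exponent modulo \<open>n\<close> together with
    three coordinates modulo \<open>M\<close>, read off after a power of \<open>\<phi>\<close> has
    moved the given finite set into the lattice.\<close>
  let ?B = "{0..<int n} \<times> {0..<M} \<times> {0..<M} \<times> {0..<M}"
  show ?thesis
  proof (rule Gc.finite_rcong_quotientI[OF subgroup_H, where B = ?B])
    fix W assume W: "finite W" "W \<subseteq> carrier Gc"
    \<comment> \<open>The quotient of \<open>(v, i)\<close> and \<open>(w, j)\<close> has first
      component \<open>zpow \<phi> (- i) (hmul (hinv v) w)\<close>. The part of the exponent
      divisible by \<open>n\<close> passes through \<open>D\<close>; the remainder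
      \<open>i mod n\<close> does not and is applied in advance. Elements of the same colour share
      it.\<close>
    define g where "g = (\<lambda>(v, i). zpow \<phi> (- (i mod int n)) v)"
    have g: "g (v, i) = zpow \<phi> (- (i mod int n)) v" for v i by (simp add: g_def)
    have "\<And>x. x \<in> W \<Longrightarrow> g x \<in> Ninf"
    proof -
      fix x assume "x \<in> W"
      then have "fst x \<in> Ninf" using W(2) by (auto simp: Gc_simps)
      then show "g x \<in> Ninf" unfolding g_def by (simp add: case_prod_beta)
    qed
    then obtain J where J: "\<And>x. x \<in> W \<Longrightarrow> (\<phi> ^^ (n * J)) (g x) \<in> heis_lattice"
      using uniform_lattice[OF W(1), of g] by blast
    define h where "h x = (\<phi> ^^ (n * J)) (g x)" for x
    define \<kappa> where "\<kappa> x = (snd x mod int n, \<lfloor>fst (h x)\<rfloor> mod M, \<lfloor>fst (snd (h x))\<rfloor> mod M,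
      \<lfloor>snd (snd (h x))\<rfloor> mod M)" for x :: "vec \<times> int"
    have "\<kappa> ` W \<subseteq> ?B" using n M by (auto simp: \<kappa>_def)
    moreover have "inv\<^bsub>Gc\<^esub> x \<otimes>\<^bsub>Gc\<^esub> y \<in> H" if xy: "x \<in> W" "y \<in> W" "\<kappa> x = \<kappa> y" for x y
    proof -
      obtain v i where x: "x = (v, i)" "v \<in> Ninf" using xy(1) W(2) by (metis Gc_simps(1) SigmaE subsetD)
      obtain w j where y: "y = (w, j)" "w \<in> Ninf" using xy(2) W(2) by (metis Gc_simps(1) SigmaE subsetD)
      have ij: "i mod int n = j mod int n" using xy(3) by (simp add: \<kappa>_def x y)
      obtain a b c where hx: "h x = (of_int a, of_int b, of_int c)"
        using J[OF xy(1)] unfolding h_def by (metis heis_latticeE)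
      obtain a' b' c' where hy: "h y = (of_int a', of_int b', of_int c')"
        using J[OF xy(2)] unfolding h_def by (metis heis_latticeE)
      have "a mod M = a' mod M" "b mod M = b' mod M" "c mod M = c' mod M"
        using xy(3) by (simp_all add: \<kappa>_def hx hy)
      then obtain e f k where "hmul (hinv (h x)) (h y) = (of_int (M * e), of_int (M * f), of_int (M * k))"
        using lattice_cong[OF hx hy] by blast
      then have D1: "D (hmul (hinv (h x)) (h y)) \<in> heis_lattice" using DM by simp
      let ?z = "hmul (hinv v) w" and ?k = "i mod int n"
      have "hmul (hinv (h x)) (h y) = zpow \<phi> (int n * int J) (zpow \<phi> (- ?k) ?z)"
        unfolding h_def x y g ij zpow_of_nat[symmetric] of_nat_mult
        by (simp only: zpow_hmul zpow_hinv)
      \<comment> \<open>Passing through \<open>D\<close> turns the exponent \<open>n * J\<close>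
        into \<open>J\<close>, and a power of \<open>\<phi>\<close> does not affect membership in
        \<open>Ninf\<close>.\<close>
      then have "zpow \<phi> (int J) (D (zpow \<phi> (- ?k) ?z)) \<in> heis_lattice"
        using D1 by (simp only: D_zpow)
      then have 2: "D (zpow \<phi> (- ?k) ?z) \<in> Ninf"
        using lattice_Ninf zpow_Ninf by blast
      have "- i = int n * (- (i div int n)) + (- ?k)" by (simp add: minus_mod_eq_mult_div[symmetric])
      then have "D (zpow \<phi> (- i) ?z) = zpow \<phi> (- (i div int n)) (D (zpow \<phi> (- ?k) ?z))"
        using zpow_\<phi>_add D_zpow by metis
      then have "D (zpow \<phi> (- i) ?z) \<in> Ninf" using 2 by simp
      moreover have "int n dvd - i + j" using ij by (metis mod_eq_dvd_iff uminus_add_conv_diff)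
      moreover have "?z \<in> Ninf" using x y by (simp add: hmul_Ninf hinv_Ninf)
      moreover have "inv\<^bsub>Gc\<^esub> x \<otimes>\<^bsub>Gc\<^esub> y = (zpow \<phi> (- i) ?z, - i + j)"
        unfolding x y Gc_inv[OF x(2)] Gc_simps zpow_hmul ..
      ultimately show ?thesis by (simp only: H_iff zpow_Ninf)
    qed
    ultimately show "\<exists>\<kappa>. \<kappa> ` W \<subseteq> ?B \<and> (\<forall>x\<in>W. \<forall>y\<in>W. \<kappa> x = \<kappa> y \<longrightarrow> inv\<^bsub>Gc\<^esub> x \<otimes>\<^bsub>Gc\<^esub> y \<in> H)"
      by blast
  qed simp
qed

section \<open>Invariant normal subgroups inside the domain\<close>

context
  fixes W assumes W: "W \<lhd> Gc" and W_H: "W \<subseteq> H" and W_F: "F ` W \<subseteq> W"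
begin

lemma core_D: "(v, i) \<in> W \<Longrightarrow> (D v, i div int n) \<in> W"
  using W_F F_simp[of v i] by (metis imageI subsetD)

lemma core_Ninf: "(v, i) \<in> W \<Longrightarrow> v \<in> Ninf"
  using W_H H_iff by blast

lemma core_subgroup: "subgroup W Gc"
  using W Gc.normal_inv_iff by blast

lemma core_commutator:
  assumes "x \<in> W" "g \<in> carrier Gc"
  shows "x \<otimes>\<^bsub>Gc\<^esub> (g \<otimes>\<^bsub>Gc\<^esub> inv\<^bsub>Gc\<^esub> x \<otimes>\<^bsub>Gc\<^esub> inv\<^bsub>Gc\<^esub> g) \<in> W"
proof (rule subgroup.m_closed[OF core_subgroup assms(1)])
  show "g \<otimes>\<^bsub>Gc\<^esub> inv\<^bsub>Gc\<^esub> x \<otimes>\<^bsub>Gc\<^esub> inv\<^bsub>Gc\<^esub> g \<in> W"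
    using W assms(2) subgroup.m_inv_closed[OF core_subgroup assms(1)] unfolding Gc.normal_inv_iff by blast
qed

text \<open>Each application of \<open>F\<close> divides \<open>c\<close> by \<open>\<beta>\<close>
  and stays in \<open>W\<close>, while \<open>centre_Ninf\<close> allows only denominators composed
  of primes of \<open>d\<close>.\<close>

lemma core_centre:
  assumes "((0, 0, c), 0) \<in> W" shows "c = 0"
proof (rule coprime_power_denominator[OF \<beta>(1,2)])
  fix j
  have \<beta>0: "of_int \<beta> \<noteq> (0::rat)" using \<beta>(1) by auto
  then have "P * S - Q * R = 1 / of_int \<beta>" using \<beta>(3) by (simp add: eq_divide_eq)
  then have D: "D (0, 0, e) = (0, 0, e / of_int \<beta>)" for e by (simp add: D_def hlin.simps)
  have "((0, 0, c / of_int (\<beta> ^ j)), 0) \<in> W"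
  proof (induction j)
    case (Suc j)
    then show ?case using core_D[of "(0, 0, c / of_int (\<beta> ^ j))" 0] by (simp add: D field_simps)
  qed (use assms in simp)
  then show "\<exists>i. of_int (d ^ i) * (c / of_int (\<beta> ^ j)) \<in> \<int>"
    using core_Ninf centre_Ninf by blast
qed

lemma lattice_gens: "(1, 0, 0) \<in> heis_lattice" "(0, 1, 0) \<in> heis_lattice"
  using heis_latticeI[of 0 1 0] heis_latticeI[of 0 0 1] by simp_all

text \<open>The commutators with x and y are central with coordinates \<open>- 2 * b\<close> and
  \<open>2 * a\<close>, and lie in \<open>W\<close> by normality; \<open>core_centre\<close> then
  removes \<open>b\<close>, \<open>a\<close> and finally \<open>c\<close>.\<close>

lemma core_Ninf_trivial:
  assumes "(v, 0) \<in> W" shows "v = (0, 0, 0)"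
proof -
  obtain a b c where v: "v = (a, b, c)" by (cases v)
  have comm: "(hmul v (hmul (hmul w (hinv v)) (hinv w)), 0) \<in> W" if "w \<in> heis_lattice" for w
  proof -
    have w: "w \<in> Ninf" using that by (rule lattice_Ninf)
    have "(w, 0) \<in> carrier Gc" using w by simp
    from core_commutator[OF assms this] show ?thesis
      using w core_Ninf[OF assms] by (simp add: Gc_inv)
  qed
  have "b = 0"
    using core_centre[of "- 2 * b"] comm[OF lattice_gens(1)] by (simp add: v hmul.simps hinv.simps)
  moreover have "a = 0"
    using core_centre[of "2 * a"] comm[OF lattice_gens(2)] by (simp add: v hmul.simps hinv.simps)
  ultimately show ?thesis using core_centre[of c] assms v by simp
qed

lemma core_exponent_nonneg:
  assumes "(v, i) \<in> W" "i > 0" shows False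
proof (cases "n \<ge> 2")
  case True
  \<comment> \<open>Infinite descent: \<open>F\<close> replaces a positive exponent by its quotient
    by \<open>n\<close>, which is positive and smaller.\<close>
  show False using assms
  proof (induction "nat i" arbitrary: v i rule: less_induct)
    case less
    then have dvd: "int n dvd i" using W_H H_iff by blast
    then obtain j where j: "i = int n * j" by blast
    have n2: "int n \<ge> 2" using True by simp
    have j0: "j > 0" using less.prems(2) n2 unfolding j by (simp add: zero_less_mult_iff)
    have "1 * j < int n * j" using n2 j0 by (intro mult_strict_right_mono) simp_all
    then have "nat j < nat i" using j0 unfolding j by simp
    moreover have "i div int n = j" using n2 unfolding j by simp
    then have "(D v, j) \<in> W" using core_D[OF less.prems(1)] by simp
    ultimately show False using less.hyps j0 by blast
  qed
next
  case False
  \<comment> \<open>For \<open>n = 1\<close>, take \<open>w\<close> moved modulo the centre by the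
    power \<open>i\<close> of \<open>\<phi>\<close>. The commutator of \<open>(v, i)\<close> with
    \<open>(w, 0)\<close> has exponent 0, hence is trivial; so this power maps \<open>w\<close> to a
    conjugate of \<open>w\<close>, which agrees with \<open>w\<close> modulo the centre.\<close>
  then obtain w where w: "w \<in> heis_lattice"
    and ne: "\<And>c. (\<phi> ^^ nat i) w \<noteq> (fst w, fst (snd w), c)"
  proof -
    have "nat i > 0" using assms(2) by simp
    then show ?thesis using alt False that by blast
  qed
  have wN: "w \<in> Ninf" using w by (rule lattice_Ninf)
  have vN: "v \<in> Ninf" using core_Ninf assms(1) by blast
  have "(w, 0) \<in> carrier Gc" using wN by simp
  from core_commutator[OF assms(1) this]
  have "(hmul v (zpow \<phi> i (hmul w (hmul (zpow \<phi> (- i) (hinv v)) (zpow \<phi> (- i) (hinv w))))), 0) \<in> W"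
    by (simp only: Gc_inv[OF vN] Gc_inv[OF wN] Gc_simps zpow_0 hmul_assoc minus_zero add_0_left
        add_0_right right_minus)
  then have "hmul v (zpow \<phi> i (hmul w (hmul (zpow \<phi> (- i) (hinv v)) (zpow \<phi> (- i) (hinv w))))) = (0, 0, 0)"
    by (rule core_Ninf_trivial)
  then have "hmul v (hmul (zpow \<phi> i w) (hmul (hinv v) (hinv w))) = (0, 0, 0)"
    by (simp only: zpow_hmul zpow_\<phi>_cancel)
  moreover have "zpow \<phi> i w = (\<phi> ^^ nat i) w" using assms(2) by (simp add: zpow_def)
  ultimately have *: "hmul v (hmul ((\<phi> ^^ nat i) w) (hmul (hinv v) (hinv w))) = (0, 0, 0)" by simp
  obtain a b c where v: "v = (a, b, c)" by (cases v)
  obtain a' b' c' where w': "w = (a', b', c')" by (cases w)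
  obtain e f g where efg: "(\<phi> ^^ nat i) w = (e, f, g)" by (cases "(\<phi> ^^ nat i) w")
  from * have "e = a'" "f = b'" unfolding efg unfolding v w' by (simp_all add: hmul.simps hinv.simps)
  then show False using ne[of g] efg w' by simp
qed

lemma core_trivial: "W = {\<one>\<^bsub>Gc\<^esub>}"
proof -
  have "x = ((0, 0, 0), 0)" if x: "x \<in> W" for x
  proof -
    obtain v i where vi: "x = (v, i)" by (cases x)
    then have "(v, i) \<in> W" "v \<in> Ninf" using x core_Ninf by auto
    \<comment> \<open>Negative exponents are excluded by passing to the inverse.\<close>
    then have "(zpow \<phi> (- i) (hinv v), - i) \<in> W"
      using subgroup.m_inv_closed[OF core_subgroup, of "(v, i)"] by (simp add: Gc_inv)
    then have "\<not> - i > 0" "\<not> i > 0" using core_exponent_nonneg \<open>(v, i) \<in> W\<close> by blast+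
    then have "i = 0" by simp
    then show ?thesis using core_Ninf_trivial \<open>(v, i) \<in> W\<close> vi by simp
  qed
  moreover have "((0, 0, 0), 0) \<in> W" using subgroup.one_closed[OF core_subgroup] by simp
  ultimately show ?thesis unfolding Gc_simps by blast
qed

end

theorem transitive_self_similar_Gc: "transitive_self_similar Gc"
proof (rule Gc.transitive_self_similar_virtual_endomorphism[OF subgroup_H finite_index F_hom core_trivial])
  have "((0, 0, 0), 1) \<in> carrier Gc" by simp
  moreover have "((0, 0, 0), 1) \<noteq> \<one>\<^bsub>Gc\<^esub>" by simp
  ultimately show "carrier Gc \<noteq> {\<one>\<^bsub>Gc\<^esub>}" by blast
qed

end

section \<open>Existence of contractions\<close>

lemma hlin_hlin:
  "hlin P Q R S L K (hlin p q r s l k v) = hlin (P * p + Q * r) (P * q + Q * s) (R * p + S * r)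
    (R * q + S * s) ((P * S - Q * R) * l + L * p + K * r) ((P * S - Q * R) * k + L * q + K * s) v"
  by (cases v) (simp add: hlin.simps algebra_simps)

lemma hlin_eqI:
  assumes "p = p'" "q = q'" "r = r'" "s = s'" "l = l'" "k = k'"
  shows "hlin p q r s l k v = hlin p' q' r' s' l' k' v"
  using assms by simp

lemma hlin_id: "hlin 1 0 0 1 0 0 v = v"
  by (cases v) (simp add: hlin.simps)

context heis_model
begin

lemma transitive_self_similarI:
  assumes "\<bar>\<beta>\<bar> \<ge> 2" "coprime \<beta> d" "(P * S - Q * R) * of_int \<beta> = 1" "n \<ge> 1"
    and "\<And>v. hlin P Q R S L K ((\<phi> ^^ n) v) = \<phi> (hlin P Q R S L K v)"
    and "n \<ge> 2 \<or> (\<forall>j>0. \<exists>v\<in>heis_lattice. \<forall>c. (\<phi> ^^ j) v \<noteq> (fst v, fst (snd v), c))"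
  shows "transitive_self_similar Gc"
proof -
  interpret heis_contraction p q r s l k P Q R S L K \<beta> n
    using assms unfolding heis_contraction_def heis_contraction_axioms_def
    by (auto intro: heis_model_axioms)
  show ?thesis by (rule transitive_self_similar_Gc)
qed

lemma funpow_\<phi>_hlin: "\<exists>a b c e f g. \<phi> ^^ j = hlin a b c e f g"
proof (induction j)
  case 0
  then show ?case using hlin_id by (metis eq_id_iff funpow_0 id_apply)
next
  case (Suc j)
  then obtain a b c e f g where *: "\<phi> ^^ j = hlin a b c e f g" by blast
  have "\<phi> ^^ Suc j = (\<lambda>v. \<phi> (hlin a b c e f g v))" by (simp add: * o_def)
  then show ?case unfolding \<phi>_def hlin_hlin by blast
qed

text \<open>Testing on x and y shows that the matrix is the identity; what remains is conjugation by
  an element of the rational group.\<close>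

lemma funpow_\<phi>_unipotent:
  assumes "\<And>v. v \<in> heis_lattice \<Longrightarrow> \<exists>c. (\<phi> ^^ j) v = (fst v, fst (snd v), c)"
  obtains f g where "\<phi> ^^ j = hlin 1 0 0 1 f g"
proof -
  obtain a b c e f g where *: "\<phi> ^^ j = hlin a b c e f g" using funpow_\<phi>_hlin by blast
  have "(1, 0, 0) \<in> heis_lattice" "(0, 1, 0) \<in> heis_lattice"
    using heis_latticeI[of 0 1 0] heis_latticeI[of 0 0 1] by simp_all
  then have "a = 1" "c = 0" "b = 0" "e = 1"
    using assms[of "(1, 0, 0)"] assms[of "(0, 1, 0)"] by (auto simp: * hlin.simps)
  then show thesis using that * by simp
qed

text \<open>A multiplier coprime to \<open>d\<close> that is admissible even for
  \<open>d = 1\<close> and \<open>d = - 1\<close>.\<close>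

lemma coprime_abs_succ: "\<bar>\<bar>d\<bar> + 1\<bar> \<ge> 2" "coprime (\<bar>d\<bar> + 1) d"
proof -
  show "\<bar>\<bar>d\<bar> + 1\<bar> \<ge> 2" using d0 by simp
  have "coprime (\<bar>d\<bar> + 1) \<bar>d\<bar>" by (rule coprime_add_one_left)
  then show "coprime (\<bar>d\<bar> + 1) d" by simp
qed

lemma of_int_d: "(of_int d :: rat) = of_int p * of_int s - of_int q * of_int r"
  by (simp add: d_def)

text \<open>The assumption is about the characteristic polynomial, at 1, of the matrix on the
  abelianisation. The eigenvalues have product \<open>d\<close>, so \<open>d\<close>, the eigenvalue
  on the centre, is excluded together with 1, and the abelian part can be decoupled from the
  centre.\<close>

lemma transitive_self_similar_no_eigenvalue_1:
  assumes ev: "1 - p - s + d \<noteq> 0"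
  shows "transitive_self_similar Gc"
proof -
  define p' q' r' s' l' k' d' :: rat where defs: "p' = of_int p" "q' = of_int q" "r' = of_int r"
    "s' = of_int s" "l' = of_int l" "k' = of_int k" "d' = of_int d"
  have d': "d' = p' * s' - q' * r'" using of_int_d by (simp add: defs)
  define b where "b = \<bar>d'\<bar> + 1"
  \<comment> \<open>\<open>e\<close> is the determinant of the matrix minus \<open>d\<close>, and
    \<open>c\<close> the difference between the scalings of the abelianisation and of the centre.
    That \<open>D\<close> commutes with \<open>\<phi>\<close> is a linear system for the row (L, K)
    with this matrix and right-hand side \<open>c\<close> times (l, k); Cramer's rule solves
    it.\<close>
  define e where "e = (p' - d') * (s' - d') - q' * r'"
  define c where "c = 1 / b - 1 / b^2"
  have b: "b > 0" unfolding b_def by simp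
  have "e = d' * of_int (1 - p - s + d)"
    unfolding e_def by (simp add: defs(7)[symmetric] flip: defs(1-6)) (simp add: d' algebra_simps)
  then have e: "e \<noteq> 0" using ev d0 by (simp add: defs)
  define L where "L = c * (l' * (s' - d') - k' * r') / e"
  define K where "K = c * (k' * (p' - d') - l' * q') / e"
  have L: "L * (p' - d') + K * r' = l' * c"
  proof -
    have "e * (L * (p' - d') + K * r') = e * (l' * c)"
      using e by (simp add: L_def K_def distrib_left) (simp add: e_def algebra_simps)
    then show ?thesis using e by simp
  qed
  have K: "L * q' + K * (s' - d') = k' * c"
  proof -
    have "e * (L * q' + K * (s' - d')) = e * (k' * c)"
      using e by (simp add: L_def K_def distrib_left) (simp add: e_def algebra_simps)
    then show ?thesis using e by simp
  qed
  \<comment> \<open>The dilation by \<open>1/b\<close> commutes with \<open>\<phi>\<close> up to an inner automorphism, which \<open>L\<close> and \<open>K\<close> absorb.\<close>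
  let ?D = "hlin (1 / b) 0 0 (1 / b) L K"
  have comm: "?D (\<phi> v) = \<phi> (?D v)" for v
  proof -
    have "1 / b * (1 / b) * l' + L * p' + K * r' = d' * L + l' * (1 / b)"
      using L by (simp add: c_def algebra_simps power2_eq_square)
    moreover have "1 / b * (1 / b) * k' + L * q' + K * s' = d' * K + k' * (1 / b)"
      using K by (simp add: c_def algebra_simps power2_eq_square)
    ultimately show ?thesis
      unfolding \<phi>_def hlin_hlin by (simp add: defs[symmetric] d'[symmetric] mult.commute)
  qed
  have \<beta>: "(1 / b * (1 / b) - 0 * 0) * of_int ((\<bar>d\<bar> + 1)^2) = 1"
    using b by (simp add: b_def defs power2_eq_square)
  have \<beta>2: "\<bar>(\<bar>d\<bar> + 1)^2\<bar> \<ge> 2" "coprime ((\<bar>d\<bar> + 1)^2) d"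
  proof -
    have "\<bar>d\<bar> + 1 \<ge> 2" using d0 by simp
    then have "2^2 \<le> (\<bar>d\<bar> + 1)^2" by (intro power_mono) simp_all
    then show "\<bar>(\<bar>d\<bar> + 1)^2\<bar> \<ge> 2" by simp
    show "coprime ((\<bar>d\<bar> + 1)^2) d" using coprime_abs_succ(2) by simp
  qed
  show ?thesis
  proof (cases "\<forall>j>0. \<exists>v\<in>heis_lattice. \<forall>c. (\<phi> ^^ j) v \<noteq> (fst v, fst (snd v), c)")
    case True
    then show ?thesis using comm by (intro transitive_self_similarI[OF \<beta>2 \<beta>, of 1 L K]) simp_all
  next
    case False
    \<comment> \<open>In this case the power \<open>j\<close> of \<open>\<phi>\<close> is
      conjugation by a rational element. Since it commutes with \<open>\<phi>\<close>, the row (f,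
      g) is annihilated by the matrix minus \<open>d\<close> and vanishes. So the power is the
      identity, the power \<open>j + 1\<close> is \<open>\<phi>\<close>, and
      \<open>n = j + 1\<close> works with the same \<open>D\<close>.\<close>
    then obtain j where j: "j > 0" "\<And>v. v \<in> heis_lattice \<Longrightarrow> \<exists>c. (\<phi> ^^ j) v = (fst v, fst (snd v), c)"
      by blast
    obtain f g where fg: "\<phi> ^^ j = hlin 1 0 0 1 f g" using j(2) by (rule funpow_\<phi>_unipotent)
    have swap: "\<phi> (hlin 1 0 0 1 f g v) = hlin 1 0 0 1 f g (\<phi> v)" for v
      using funpow_swap1[of \<phi> j v] by (simp add: fg)
    have f: "d' * f + l' = l' + f * p' + g * r'" and g: "d' * g + k' = k' + f * q' + g * s'"
      using swap[of "(1, 0, 0)"] swap[of "(0, 1, 0)"]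
      by (simp_all add: \<phi>_def hlin.simps defs[symmetric] d'[symmetric])
    \<comment> \<open>Multiplication by the adjugate of the matrix minus \<open>d\<close>.\<close>
    have "f * e = (s' - d') * (f * p' + g * r' - d' * f) - r' * (f * q' + g * s' - d' * g)"
      "g * e = (p' - d') * (f * q' + g * s' - d' * g) - q' * (f * p' + g * r' - d' * f)"
      by (simp_all add: e_def algebra_simps)
    moreover have "f * p' + g * r' - d' * f = 0" "f * q' + g * s' - d' * g = 0"
      using f g by simp_all
    ultimately have "f * e = 0" "g * e = 0" by simp_all
    then have "f = 0" "g = 0" using e by simp_all
    then have "(\<phi> ^^ j) v = v" for v by (simp add: fg hlin_id)
    then have "(\<phi> ^^ (j + 1)) v = \<phi> v" for v by (simp add: funpow_swap1)
    then show ?thesis using comm j(1)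
      by (intro transitive_self_similarI[OF \<beta>2 \<beta>, of "j + 1" L K]) simp_all
  qed
qed

text \<open>The eigenvalues on the abelianisation are 1 and \<open>d\<close>, and \<open>d\<close>
  occurs again on the centre. Scaling the part belonging to \<open>d\<close> alone already scales
  the centre.\<close>

lemma transitive_self_similar_eigenvalue_1:
  assumes ev: "p + s = 1 + d" and d2: "\<bar>d\<bar> \<ge> 2"
  shows "transitive_self_similar Gc"
proof -
  define p' q' r' s' l' k' d' :: rat where defs: "p' = of_int p" "q' = of_int q" "r' = of_int r"
    "s' = of_int s" "l' = of_int l" "k' = of_int k" "d' = of_int d"
  have d': "d' = p' * s' - q' * r'" using of_int_d by (simp add: defs)
  have s': "s' = 1 + d' - p'" using ev by (simp add: defs flip: of_int_add)
  have d1: "1 - d' \<noteq> 0" using d2 by (auto simp: defs)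
  define b where "b = \<bar>d'\<bar> + 1"
  have b: "b > 0" unfolding b_def by simp
  \<comment> \<open>\<open>e\<close> and \<open>h\<close> are the coefficients in 1 + e(1 - X) + h(X
    - 1)(X - d), which has value 1 at 1, value 1/b at d and derivative 0 at d. On the abelianisation
    the quadratic term vanishes by Cayley-Hamilton.\<close>
  define e where "e = (1 / b - 1) / (1 - d')"
  have e: "e * (1 - d') = 1 / b - 1" using d1 by (simp add: e_def)
  define h where "h = - e / (1 - d')"
  have h: "h * (1 - d') = - e" using d1 by (simp add: h_def)
  \<comment> \<open>\<open>D\<close> is the polynomial in \<open>\<phi>\<close> that is the identity on the eigenspace of \<open>1\<close> and \<open>1/b\<close> on the
    generalised eigenspace of \<open>d\<close>.\<close>
  define P Q R S L K where PQ: "P = 1 + e * (1 - p')" "Q = - e * q'" "R = - e * r'" "S = 1 + e * (1 - s')"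
    "L = h * (l' * (p' - d') + k' * r')" "K = h * (l' * q' + k' * (s' - d'))"
  have qr: "q' * r' = p' * s' - d'" using d' by simp
  have "P * S - Q * R = 1 + e * (2 - (p' + s')) + e\<^sup>2 * ((1 - p') * (1 - s') - q' * r')"
    by (simp add: PQ algebra_simps power2_eq_square)
  \<comment> \<open>This is the characteristic polynomial at its root 1.\<close>
  also have "(1 - p') * (1 - s') - q' * r' = 0" unfolding qr s' by (simp add: algebra_simps)
  also have "1 + e * (2 - (p' + s')) + e\<^sup>2 * 0 = 1 / b" using e unfolding s' by (simp add: algebra_simps)
  finally have E: "P * S - Q * R = 1 / b" .
  let ?D = "hlin P Q R S L K"
  have comm: "?D (\<phi> v) = \<phi> (?D v)" for v
  proof -
    have "P * p' + Q * r' = p' * P + q' * R" "P * q' + Q * s' = p' * Q + q' * S"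
      "R * p' + S * r' = r' * P + s' * R" "R * q' + S * s' = r' * Q + s' * S"
      by (simp_all add: PQ algebra_simps)
    moreover have "1 / b * l' + L * p' + K * r' = d' * L + l' * P + k' * R"
    proof -
      have "L * (p' - d') + K * r' = h * (1 - d') * (l' * (p' - d') + k' * r')"
      proof -
        have "L * (p' - d') + K * r' = h * (l' * ((p' - d')\<^sup>2 + q' * r') + k' * r' * (p' + s' - 2 * d'))"
          by (simp add: PQ algebra_simps power2_eq_square)
        also have "(p' - d')\<^sup>2 + q' * r' = (1 - d') * (p' - d')"
          unfolding qr s' by (simp add: algebra_simps power2_eq_square)
        also have "p' + s' - 2 * d' = 1 - d'" unfolding s' by simp
        finally show ?thesis by (simp add: algebra_simps)
      qed
      then have "L * (p' - d') + K * r' = - e * (l' * (p' - d') + k' * r')" using h by simp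
      moreover have eb: "1 / b = 1 + e * (1 - d')" using e by simp
      ultimately show ?thesis unfolding eb by (simp add: PQ(1-4) algebra_simps)
    qed
    moreover have "1 / b * k' + L * q' + K * s' = d' * K + l' * Q + k' * S"
    proof -
      have "L * q' + K * (s' - d') = h * (1 - d') * (l' * q' + k' * (s' - d'))"
      proof -
        have "L * q' + K * (s' - d') = h * (k' * ((s' - d')\<^sup>2 + q' * r') + l' * q' * (p' + s' - 2 * d'))"
          by (simp add: PQ algebra_simps power2_eq_square)
        also have "(s' - d')\<^sup>2 + q' * r' = (1 - d') * (s' - d')"
          unfolding qr s' by (simp add: algebra_simps power2_eq_square)
        also have "p' + s' - 2 * d' = 1 - d'" unfolding s' by simp
        finally show ?thesis by (simp add: algebra_simps)
      qed
      then have "L * q' + K * (s' - d') = - e * (l' * q' + k' * (s' - d'))" using h by simp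
      moreover have eb: "1 / b = 1 + e * (1 - d')" using e by simp
      ultimately show ?thesis unfolding eb by (simp add: PQ(1-4) algebra_simps)
    qed
    ultimately show ?thesis
      unfolding \<phi>_def hlin_hlin defs[symmetric] d'[symmetric] E by (simp add: mult.commute)
  qed
  have \<beta>: "(P * S - Q * R) * of_int (\<bar>d\<bar> + 1) = 1"
    unfolding E using b by (simp add: b_def defs)
  \<comment> \<open>This allows \<open>n = 1\<close>: a power of \<open>\<phi>\<close> trivial
    modulo the centre would have determinant 1, but its determinant is \<open>d ^ j\<close>.\<close>
  have "\<exists>v\<in>heis_lattice. \<forall>c. (\<phi> ^^ j) v \<noteq> (fst v, fst (snd v), c)" if "j > 0" for j
  proof (rule ccontr)
    assume "\<not> ?thesis"
    then obtain f g where fg: "\<phi> ^^ j = hlin 1 0 0 1 f g" using funpow_\<phi>_unipotent[of j] by blast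
    have "(\<phi> ^^ i) (0, 0, 1) = (0, 0, of_int (d ^ i))" for i
    proof (induction i)
      case (Suc i)
      have "(\<phi> ^^ Suc i) (0, 0, 1) = \<phi> ((\<phi> ^^ i) (0, 0, 1))" by simp
      then show ?case unfolding Suc by (simp add: \<phi>_def d_def hlin.simps)
    qed simp
    from this[of j] have "rat_of_int (d ^ j) = 1" unfolding fg by (simp add: hlin.simps)
    then have "d ^ j = 1" by (simp only: of_int_eq_1_iff)
    then have "\<bar>d\<bar> ^ j = 1" by (simp flip: power_abs)
    moreover have "1 < \<bar>d\<bar> ^ j" using d2 that by (intro one_less_power) simp_all
    ultimately show False by simp
  qed
  then show ?thesis using comm by (intro transitive_self_similarI[OF coprime_abs_succ \<beta>, of 1 L K]) simp_all
qed

lemma transitive_self_similar_det_minus_1: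
  assumes ev: "p + s = 0" and d: "d = - 1"
  shows "transitive_self_similar Gc"
proof -
  define p' q' r' s' l' k' :: rat where defs: "p' = of_int p" "q' = of_int q" "r' = of_int r"
    "s' = of_int s" "l' = of_int l" "k' = of_int k"
  have s': "s' = - p'" using ev by (simp add: defs flip: of_int_add of_int_minus)
  have qr: "q' * r' = 1 - p' * p'" using of_int_d s' by (simp add: d flip: defs)
  have \<phi>: "\<phi> = hlin p' q' r' (- p') l' k'" unfolding \<phi>_def by (simp add: s' flip: defs)
  have det': "p' * (- p') - q' * r' = - 1" using qr by simp
  have \<phi>2: "\<phi> (\<phi> v) = hlin 1 0 0 1 (l' * (p' - 1) + k' * r') (l' * q' - k' * (p' + 1)) v" for v
    unfolding \<phi> hlin_hlin det' using qr by (simp add: algebra_simps)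
  \<comment> \<open>The matrix squares to 1, so odd powers of it agree. On the generalised
    eigenspace of -1, which contains the centre, the third power triples the coupling to the centre,
    and the scalings 1/3 and 1/9 divide it by 3 again. The central row \<open>l' / 9\<close>,
    \<open>k' / 9\<close> is what the eigenvalue 1 requires; the eigenvalue -1 leaves it
    free.\<close>
  have "hlin (1 / 3) 0 0 (1 / 3) (l' / 9) (k' / 9) (\<phi> (\<phi> (\<phi> v))) =
    \<phi> (hlin (1 / 3) 0 0 (1 / 3) (l' / 9) (k' / 9) v)" for v
    unfolding \<phi>2 unfolding \<phi> hlin_hlin det'
    by (rule hlin_eqI) (use qr in \<open>simp_all add: algebra_simps\<close>)
  then show ?thesis
    by (intro transitive_self_similarI[where \<beta> = 9 and n = 3 and P = "1/3" and Q = 0 and R = 0 and S = "1/3"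
          and L = "l' / 9" and K = "k' / 9"]) (simp_all add: d numeral_eq_Suc)
qed

text \<open>Here \<open>\<phi>\<close> is unipotent. Squaring doubles the leading part of
  \<open>\<phi>\<close> minus 1, so with \<open>n = 2\<close> the eigenvalue of \<open>D\<close> has
  to halve along each application of it.\<close>

lemma transitive_self_similar_det_1:
  assumes ev: "p + s = 2" and d: "d = 1"
  shows "transitive_self_similar Gc"
proof -
  define p' q' r' s' l' k' :: rat where defs: "p' = of_int p" "q' = of_int q" "r' = of_int r"
    "s' = of_int s" "l' = of_int l" "k' = of_int k"
  have s': "s' = 2 - p'" using ev by (simp add: defs flip: of_int_add of_int_minus)
  have qr: "q' * r' = p' * (2 - p') - 1" using of_int_d s' by (simp add: d flip: defs)
  have \<phi>: "\<phi> = hlin p' q' r' (2 - p') l' k'" unfolding \<phi>_def by (simp add: s' flip: defs)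
  have det': "p' * (2 - p') - q' * r' = 1" using qr by simp
  have two: "(\<phi> ^^ 2) v = \<phi> (\<phi> v)" for v by (simp add: numeral_eq_Suc)
  \<comment> \<open>Unless \<open>\<phi>\<close> is trivial on the abelianisation, \<open>G\<close> is commensurable with the filiform group of class 3,
    graded by the weights 1, 1, 2, 3 of \<open>t, y, [t, y], [[t, y], y]\<close>; hence the factors \<open>1/2\<close>, \<open>1/4\<close>, \<open>1/8\<close>.\<close>
  consider "r \<noteq> 0" | "r = 0" "q \<noteq> 0" | "r = 0" "q = 0" by blast
  then show ?thesis
  proof cases
    case 1
    then have r': "r' \<noteq> 0" by (simp add: defs)
    have q': "q' = (p' * (2 - p') - 1) / r'" using qr r' by (simp add: field_simps)
    \<comment> \<open>On the abelianisation, (1, 0) has eigenvalue 1/2 and its image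
      \<open>(p' - 1, r')\<close> under the matrix minus 1 has eigenvalue 1/4. The last coefficient
      solves the condition on the central row.\<close>
    let ?D = "hlin (1 / 2) (- (p' - 1) / (4 * r')) 0 (1 / 4) 0 ((l' / 8 - (l' * (p' - 1) + k' * r') / 16) / r')"
    have "?D (\<phi> (\<phi> v)) = \<phi> (?D v)" for v
      unfolding \<phi> hlin_hlin det' by (rule hlin_eqI) (use r' in \<open>simp_all add: q' field_simps\<close>)
    then show ?thesis using r'
      by (intro transitive_self_similarI[where \<beta> = 8 and n = 2, of "1/2" "1/4" "- (p' - 1) / (4 * r')" 0 0
        "(l' / 8 - (l' * (p' - 1) + k' * r') / 16) / r'"]) (simp_all add: d two)
  next
    case 2
    then have "p' * (2 - p') = 1" "q' \<noteq> 0" using qr by (simp_all add: defs)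
    then have "(p' - 1)^2 = 0" by (simp add: power2_eq_square algebra_simps)
    then have p': "p' = 1" by simp
    \<comment> \<open>Now (0, 1) has eigenvalue 1/2, and (1, 0), which spans the image of the matrix
      minus 1, has eigenvalue 1/4.\<close>
    let ?D = "hlin (1 / 4) 0 0 (1 / 2) (k' / (8 * q') - l' / 16) 0"
    have "?D (\<phi> (\<phi> v)) = \<phi> (?D v)" for v
      unfolding \<phi> hlin_hlin det' by (rule hlin_eqI) (use \<open>q' \<noteq> 0\<close> 2(1) in \<open>simp_all add: p' defs(3) field_simps\<close>)
    then show ?thesis
      by (intro transitive_self_similarI[where \<beta> = 8 and n = 2, of "1/4" "1/2" 0 0 "k' / (8 * q') - l' / 16" 0])
         (simp_all add: d two)
  next
    case 3
    then have "p' * (2 - p') = 1" using qr by (simp_all add: defs)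
    then have "(p' - 1)^2 = 0" by (simp add: power2_eq_square algebra_simps)
    then have p': "p' = 1" by simp
    \<comment> \<open>Here \<open>\<phi>\<close> is conjugation by a rational element, and the
      graded dilation halves its coupling to the centre, which squaring has doubled.\<close>
    let ?D = "hlin (1 / 2) 0 0 (1 / 2) 0 0"
    have "?D (\<phi> (\<phi> v)) = \<phi> (?D v)" for v
      unfolding \<phi> hlin_hlin det' by (rule hlin_eqI) (use 3 in \<open>simp_all add: p' defs(2,3) field_simps\<close>)
    then show ?thesis
      by (intro transitive_self_similarI[where \<beta> = 4 and n = 2, of "1/2" "1/2" 0 0 0 0])
         (simp_all add: d two)
  qed
qed

theorem transitive_self_similar_model: "transitive_self_similar Gc"
proof -
  \<comment> \<open>If 1 is an eigenvalue, the other one is \<open>d\<close>; the values -1 and 1 of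
    \<open>d\<close> then fix the trace to be 0 or 2.\<close>
  consider "1 - p - s + d \<noteq> 0" | "p + s = 1 + d" "\<bar>d\<bar> \<ge> 2" | "p + s = 0" "d = - 1" | "p + s = 2" "d = 1"
    using d0 by linarith
  then show ?thesis
    by cases (fact transitive_self_similar_no_eigenvalue_1 transitive_self_similar_eigenvalue_1
      transitive_self_similar_det_minus_1 transitive_self_similar_det_1)+
qed

end

section \<open>Homomorphisms from presented groups\<close>

definition gword_eval :: "('b, 'c) monoid_scheme \<Rightarrow> ('a \<Rightarrow> 'b) \<Rightarrow> 'a gword \<Rightarrow> 'b" where
  "gword_eval M \<gamma> w =
    foldr (\<lambda>(a, e) u. (if e then \<gamma> a else inv\<^bsub>M\<^esub> (\<gamma> a)) \<otimes>\<^bsub>M\<^esub> u) w \<one>\<^bsub>M\<^esub>"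

lemma gword_eval_simps [simp]:
  "gword_eval M \<gamma> [] = \<one>\<^bsub>M\<^esub>"
  "gword_eval M \<gamma> ((a, e) # w) =
    (if e then \<gamma> a else inv\<^bsub>M\<^esub> (\<gamma> a)) \<otimes>\<^bsub>M\<^esub> gword_eval M \<gamma> w"
  by (simp_all add: gword_eval_def)

lemma gwords_simps [simp]:
  "[] \<in> gwords S" "(a, e) # w \<in> gwords S \<longleftrightarrow> a \<in> S \<and> w \<in> gwords S"
  "u @ v \<in> gwords S \<longleftrightarrow> u \<in> gwords S \<and> v \<in> gwords S"
  by (auto simp: gwords_def)

lemma gword_inv_simps [simp]:
  "gword_inv [] = []" "gword_inv ((a, e) # w) = gword_inv w @ [(a, \<not> e)]"
  by (simp_all add: gword_inv_def)

lemma gword_inv_gwords [simp]: "gword_inv w \<in> gwords S \<longleftrightarrow> w \<in> gwords S"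
  by (induction w) auto

context group
begin

context
  fixes S :: "'c set" and \<gamma> :: "'c \<Rightarrow> 'a"
  assumes \<gamma>: "\<gamma> ` S \<subseteq> carrier G"
begin

lemma gen_closed [simp]: "a \<in> S \<Longrightarrow> \<gamma> a \<in> carrier G"
  using \<gamma> by blast

lemma gword_eval_closed [simp]: "w \<in> gwords S \<Longrightarrow> gword_eval G \<gamma> w \<in> carrier G"
  by (induction w) auto

lemma gword_eval_append:
  "u \<in> gwords S \<Longrightarrow> v \<in> gwords S \<Longrightarrow> gword_eval G \<gamma> (u @ v) = gword_eval G \<gamma> u \<otimes> gword_eval G \<gamma> v"
  by (induction u) (auto simp: m_assoc)

lemma gword_eval_inv: "w \<in> gwords S \<Longrightarrow> gword_eval G \<gamma> (gword_inv w) = inv (gword_eval G \<gamma> w)"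
  by (induction w) (auto simp: gword_eval_append inv_mult_group)

lemma gword_eval_commutator:
  "u \<in> gwords S \<Longrightarrow> v \<in> gwords S \<Longrightarrow> gword_eval G \<gamma> (gword_commutator u v) =
    gword_eval G \<gamma> u \<otimes> gword_eval G \<gamma> v \<otimes> inv (gword_eval G \<gamma> u) \<otimes> inv (gword_eval G \<gamma> v)"
  by (simp add: gword_commutator_def gword_eval_append gword_eval_inv m_assoc)

lemma gword_eval_cong:
  assumes R: "\<And>r s. (r, s) \<in> R \<Longrightarrow> r \<in> gwords S \<Longrightarrow> s \<in> gwords S \<Longrightarrow>
      gword_eval G \<gamma> r = gword_eval G \<gamma> s"
    and "gword_eq S R u v"
  shows "gword_eval G \<gamma> u = gword_eval G \<gamma> v"
  using assms(2)
proof (induction rule: gword_eq.induct)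
  case (cancel u v a e)
  have "(if e then \<gamma> a else inv (\<gamma> a)) \<otimes> ((if \<not> e then \<gamma> a else inv (\<gamma> a)) \<otimes> gword_eval G \<gamma> v)
    = gword_eval G \<gamma> v"
    using cancel by (cases e) (simp_all add: m_assoc[symmetric])
  then show ?case using cancel by (simp add: gword_eval_append)
next
  case (relation u v r s)
  then show ?case using R[of r s] by (simp add: gword_eval_append)
qed simp_all

end

end

definition presented_hom :: "('b, 'c) monoid_scheme \<Rightarrow> ('a \<Rightarrow> 'b) \<Rightarrow> 'a gword set \<Rightarrow> 'b" where
  "presented_hom M \<gamma> C = gword_eval M \<gamma> (SOME w. w \<in> C)"

text \<open>This is von Dyck's theorem. Evaluation is constant on classes by induction on
  \<open>gword_eq\<close>, so the word chosen in \<open>presented_hom\<close> does not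
  matter.\<close>

lemma (in group) presented_hom:
  assumes \<gamma>: "\<gamma> ` S \<subseteq> carrier G"
    and R: "\<And>r s. (r, s) \<in> R \<Longrightarrow> r \<in> gwords S \<Longrightarrow> s \<in> gwords S \<Longrightarrow>
      gword_eval G \<gamma> r = gword_eval G \<gamma> s"
  shows presented_hom_class:
      "w \<in> gwords S \<Longrightarrow> presented_hom G \<gamma> (gword_class S R w) = gword_eval G \<gamma> w"
    and presented_hom_hom: "presented_hom G \<gamma> \<in> hom (presented_group S R) G"
proof -
  have cls: "presented_hom G \<gamma> (gword_class S R w) = gword_eval G \<gamma> w" if "w \<in> gwords S" for w
  proof -
    have "w \<in> gword_class S R w" using that by (simp add: gword_class_def gword_eq.refl)
    then have "gword_eq S R w (SOME u. u \<in> gword_class S R w)"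
      using someI[of "\<lambda>u. u \<in> gword_class S R w"] by (simp add: gword_class_def)
    then show ?thesis unfolding presented_hom_def by (metis gword_eval_cong[OF \<gamma> R])
  qed
  then show "w \<in> gwords S \<Longrightarrow> presented_hom G \<gamma> (gword_class S R w) = gword_eval G \<gamma> w" .
  show "presented_hom G \<gamma> \<in> hom (presented_group S R) G"
  proof (rule homI)
    fix U V assume "U \<in> carrier (presented_group S R)" "V \<in> carrier (presented_group S R)"
    then obtain u v where "U = gword_class S R u" "u \<in> gwords S" "V = gword_class S R v" "v \<in> gwords S"
      by (auto simp: presented_group_def)
    then show "presented_hom G \<gamma> (U \<otimes>\<^bsub>presented_group S R\<^esub> V) = presented_hom G \<gamma> U \<otimes> presented_hom G \<gamma> V"
      by (simp add: presented_group_mult cls gword_eval_append[OF \<gamma>])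
  qed (auto simp: presented_group_def cls gword_eval_closed[OF \<gamma>])
qed

definition presented_gen :: "'a set \<Rightarrow> ('a gword \<times> 'a gword) set \<Rightarrow> 'a \<Rightarrow> 'a gword set" where
  "presented_gen S R a = gword_class S R [(a, True)]"

lemma presented_gen_closed:
  "a \<in> S \<Longrightarrow> presented_gen S R a \<in> carrier (presented_group S R)"
proof -
  assume "a \<in> S"
  then have "[(a, True)] \<in> gwords S" by simp
  then have "gword_class S R [(a, True)] \<in> gword_class S R ` gwords S" by (rule imageI)
  then show ?thesis unfolding presented_gen_def presented_group_def partial_object.select_convs .
qed

lemma presented_gen_image: "presented_gen S R ` S \<subseteq> carrier (presented_group S R)"
  by (rule image_subsetI) (rule presented_gen_closed)

lemma gword_class_eval:
  "w \<in> gwords S \<Longrightarrow> gword_class S R w = gword_eval (presented_group S R) (presented_gen S R) w"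
proof (induction w)
  case Nil
  then show ?case unfolding presented_group_def by simp
next
  case (Cons x w)
  interpret group "presented_group S R" by (rule group_presented_group)
  obtain a e where x: "x = (a, e)" by force
  then have w: "a \<in> S" "w \<in> gwords S" using Cons.prems by auto
  have inv: "inv\<^bsub>presented_group S R\<^esub> (presented_gen S R a) = gword_class S R [(a, False)]"
  proof (rule inv_equality)
    show "gword_class S R [(a, False)] \<otimes>\<^bsub>presented_group S R\<^esub> presented_gen S R a
      = \<one>\<^bsub>presented_group S R\<^esub>"
      using w gword_inv_left[of "[(a, True)]" S R]
      by (simp add: presented_gen_def presented_group_mult gword_class_eq_iff)
         (simp add: presented_group_def gword_class_eq_iff)
  qed (use w presented_gen_closed in \<open>auto simp: presented_group_def\<close>)
  have "gword_class S R (x # w) = gword_class S R [(a, e)] \<otimes>\<^bsub>presented_group S R\<^esub> gword_class S R w"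
    using w by (simp add: presented_group_mult x)
  then show ?case using Cons.IH w by (cases e) (simp_all add: x inv flip: presented_gen_def)
qed

lemma presented_group_relation:
  assumes "(r, s) \<in> R" "r \<in> gwords S" "s \<in> gwords S"
  shows "gword_eval (presented_group S R) (presented_gen S R) r
    = gword_eval (presented_group S R) (presented_gen S R) s"
proof -
  have "gword_eq S R r s" using gword_eq.relation[of "[]" S "[]" r s R] assms by simp
  then show ?thesis using assms by (simp add: gword_class_eval[symmetric] gword_class_eq_iff)
qed

text \<open>Induction on the letters of a word. It serves to establish normal forms: only left
  multiplication by a generator or its inverse has to be brought back into the form.\<close>

lemma presented_group_induct [consumes 1, case_names one gen inv]:
  assumes "g \<in> carrier (presented_group S R)"
    and "P \<one>\<^bsub>presented_group S R\<^esub>"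
    and "\<And>a g. a \<in> S \<Longrightarrow> g \<in> carrier (presented_group S R) \<Longrightarrow> P g \<Longrightarrow>
      P (presented_gen S R a \<otimes>\<^bsub>presented_group S R\<^esub> g)"
    and "\<And>a g. a \<in> S \<Longrightarrow> g \<in> carrier (presented_group S R) \<Longrightarrow> P g \<Longrightarrow>
      P (inv\<^bsub>presented_group S R\<^esub> (presented_gen S R a) \<otimes>\<^bsub>presented_group S R\<^esub> g)"
  shows "P g"
proof -
  interpret group "presented_group S R" by (rule group_presented_group)
  have "P (gword_eval (presented_group S R) (presented_gen S R) w)" if "w \<in> gwords S" for w
    using that
  proof (induction w)
    case (Cons x w)
    then show ?case using assms(3,4) gword_eval_closed[OF presented_gen_image] by (cases x) auto
  qed (simp add: assms(2))
  then show ?thesis using assms(1) gword_class_eval by (force simp: presented_group_def)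
qed

lemma presented_hom_gen:
  assumes "group M" "\<gamma> ` S \<subseteq> carrier M"
    and "\<And>r s. (r, s) \<in> R \<Longrightarrow> r \<in> gwords S \<Longrightarrow> s \<in> gwords S \<Longrightarrow>
      gword_eval M \<gamma> r = gword_eval M \<gamma> s"
    and "a \<in> S"
  shows "presented_hom M \<gamma> (presented_gen S R a) = \<gamma> a"
proof -
  interpret group M by fact
  have "\<gamma> a \<in> carrier M" using assms(2,4) by blast
  then show ?thesis using presented_hom_class[OF assms(2,3), where w = "[(a, True)]"] assms(4)
    by (simp add: presented_gen_def)
qed

lemma presented_group_hom_eqI:
  assumes "group M" "f \<in> hom (presented_group S R) M" "h \<in> hom (presented_group S R) M"
    and eq: "\<And>a. a \<in> S \<Longrightarrow> f (presented_gen S R a) = h (presented_gen S R a)"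
    and "g \<in> carrier (presented_group S R)"
  shows "f g = h g"
proof -
  interpret f: group_hom "presented_group S R" M f
    using assms group_presented_group by (simp add: group_hom_def group_hom_axioms_def)
  interpret h: group_hom "presented_group S R" M h
    using assms group_presented_group by (simp add: group_hom_def group_hom_axioms_def)
  show ?thesis using assms(5)
    by (induction rule: presented_group_induct) (simp_all add: eq presented_gen_closed)
qed

section \<open>Collection in a group generated by two elements with central commutator\<close>

lemma (in group) int_pow_Suc:
  fixes i :: int
  assumes "x \<in> carrier G" shows "x [^] (i + 1) = x [^] i \<otimes> x" "x [^] (i + 1) = x \<otimes> x [^] i"
    "inv x \<otimes> x [^] i = x [^] (i - 1)"
proof -
  show "x [^] (i + 1) = x [^] i \<otimes> x" using assms by (simp add: int_pow_mult)
  show *: "x [^] (i + 1) = x \<otimes> x [^] i" using assms int_pow_mult[of x 1 i] by (simp add: add.commute)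
  have "x [^] i = x \<otimes> x [^] (i - 1)" using assms int_pow_mult[of x 1 "i - 1"] by simp
  then show "inv x \<otimes> x [^] i = x [^] (i - 1)" using assms by (simp add: m_assoc[symmetric])
qed

lemma (in group) inv_commute:
  assumes "x \<in> carrier G" "y \<in> carrier G" "x \<otimes> y = y \<otimes> x"
  shows "inv x \<otimes> y = y \<otimes> inv x"
proof -
  have "x \<otimes> (inv x \<otimes> y) = x \<otimes> (y \<otimes> inv x)"
    using assms by (simp add: m_assoc[symmetric]) (simp add: m_assoc)
  then show ?thesis using assms by simp
qed

lemma (in group) int_pow_commute:
  fixes i :: int
  assumes "x \<in> carrier G" "y \<in> carrier G" "x \<otimes> y = y \<otimes> x"
  shows "x [^] i \<otimes> y = y \<otimes> x [^] i"
proof (induction i rule: int_induct[where k = 0])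
  case (step1 i)
  then show ?case using assms by (simp add: int_pow_Suc(1)) (metis assms int_pow_closed m_assoc)
next
  case (step2 i)
  have "x [^] (i - 1) \<otimes> y = inv x \<otimes> (x [^] i \<otimes> y)"
    using assms by (simp add: int_pow_Suc(3)[symmetric] m_assoc)
  also have "\<dots> = inv x \<otimes> y \<otimes> x [^] i" using step2 assms by (simp add: m_assoc)
  also have "\<dots> = y \<otimes> x [^] (i - 1)"
    using assms inv_commute[OF assms] by (simp add: int_pow_Suc(3)[symmetric] m_assoc)
  finally show ?case .
qed (use assms in simp)

context group
begin

definition nf :: "'a \<Rightarrow> 'a \<Rightarrow> 'a \<Rightarrow> int \<Rightarrow> int \<Rightarrow> int \<Rightarrow> 'a" where
  "nf x y z a b c = x [^] a \<otimes> y [^] b \<otimes> z [^] c"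

context
  fixes x y z
  assumes xyz: "x \<in> carrier G" "y \<in> carrier G" "z = x \<otimes> y \<otimes> inv x \<otimes> inv y"
    and zx: "z \<otimes> x = x \<otimes> z" and zy: "z \<otimes> y = y \<otimes> z"
begin

lemma z_closed: "z \<in> carrier G"
  using xyz by simp

lemma xy_eq: "x \<otimes> y = z \<otimes> y \<otimes> x"
  using xyz by (simp add: m_assoc)

text \<open>Each exchange of x and y costs one central factor z. The mirrored rule for
  \<open>x [^] i \<otimes> y\<close> is proved first, by induction in both directions.\<close>

lemma yx_pow: "y \<otimes> x [^] (i::int) = z [^] (- i) \<otimes> x [^] i \<otimes> y"
proof -
  note c = xyz(1,2) z_closed
  have zp: "z [^] j \<otimes> x = x \<otimes> z [^] j" for j :: int by (rule int_pow_commute) (use c zx in simp_all)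
  have *: "x [^] i \<otimes> y = z [^] i \<otimes> y \<otimes> x [^] i" for i :: int
  proof (induction i rule: int_induct[where k = 0])
    case (step1 i)
    have "x [^] (i + 1) \<otimes> y = x \<otimes> (x [^] i \<otimes> y)" using c by (simp add: int_pow_Suc(2) m_assoc)
    also have "\<dots> = x \<otimes> z [^] i \<otimes> y \<otimes> x [^] i" using c step1 by (simp add: m_assoc)
    also have "\<dots> = z [^] i \<otimes> (x \<otimes> y) \<otimes> x [^] i" using c by (simp add: zp[symmetric] m_assoc)
    also have "\<dots> = z [^] (i + 1) \<otimes> y \<otimes> x [^] (i + 1)"
      unfolding xy_eq using c by (simp add: int_pow_Suc(1)[OF c(3)] int_pow_Suc(2)[OF c(1)] m_assoc)
    finally show ?case .
  next
    case (step2 i)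
    have "x \<otimes> (z [^] (i - 1) \<otimes> y \<otimes> x [^] (i - 1)) = z [^] (i - 1) \<otimes> (x \<otimes> y) \<otimes> x [^] (i - 1)"
      using c by (simp add: m_assoc[symmetric] zp)
    also have "\<dots> = z [^] ((i - 1) + 1) \<otimes> y \<otimes> x [^] ((i - 1) + 1)"
      unfolding xy_eq using c by (simp only: int_pow_Suc(1)[OF c(3)] int_pow_Suc(2)[OF c(1)])
        (simp add: m_assoc)
    also have "\<dots> = x [^] ((i - 1) + 1) \<otimes> y" using step2 by simp
    also have "\<dots> = x \<otimes> (x [^] (i - 1) \<otimes> y)"
      using c by (simp only: int_pow_Suc(2)[OF c(1)]) (simp add: m_assoc)
    finally show ?case using c by (simp add: m_closed)
  qed (use c in simp)
  have "z [^] (- i) \<otimes> x [^] i \<otimes> y = z [^] (- i) \<otimes> z [^] i \<otimes> y \<otimes> x [^] i"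
    using c *[of i] by (simp add: m_assoc)
  also have "z [^] (- i) \<otimes> z [^] i = \<one>" using c by (simp add: int_pow_neg)
  finally show ?thesis using c by simp
qed

lemma nf_x: "x \<otimes> nf x y z a b c = nf x y z (a + 1) b c" "inv x \<otimes> nf x y z a b c = nf x y z (a - 1) b c"
  using xyz(1,2) z_closed unfolding nf_def
  by (simp_all add: m_assoc int_pow_Suc(2)[OF xyz(1)] int_pow_Suc(3)[OF xyz(1), symmetric])

lemma nf_y: "y \<otimes> nf x y z a b c = nf x y z a (b + 1) (c - a)" "inv y \<otimes> nf x y z a b c = nf x y z a (b - 1) (c + a)"
proof -
  note cl = xyz(1,2) z_closed
  have zp: "z [^] j \<otimes> x [^] i = x [^] i \<otimes> z [^] j" for i j :: int
    by (rule int_pow_commute) (use cl zx in \<open>simp_all add: int_pow_commute[symmetric]\<close>)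
  have zp': "z [^] j \<otimes> y [^] i = y [^] i \<otimes> z [^] j" for i j :: int
    by (rule int_pow_commute) (use cl zy in \<open>simp_all add: int_pow_commute[symmetric]\<close>)
  have main: "y \<otimes> nf x y z a b c = nf x y z a (b + 1) (c - a)" for b c
  proof -
    have "y \<otimes> nf x y z a b c = (y \<otimes> x [^] a) \<otimes> y [^] b \<otimes> z [^] c"
      unfolding nf_def using cl by (simp add: m_assoc)
    also have "\<dots> = (z [^] (- a) \<otimes> x [^] a) \<otimes> (y \<otimes> y [^] b) \<otimes> z [^] c"
      unfolding yx_pow using cl by (simp add: m_assoc)
    also have "\<dots> = x [^] a \<otimes> (z [^] (- a) \<otimes> y [^] (b + 1)) \<otimes> z [^] c"
      unfolding zp int_pow_Suc(2)[OF cl(2)] using cl by (simp add: m_assoc)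
    also have "\<dots> = x [^] a \<otimes> y [^] (b + 1) \<otimes> (z [^] (- a) \<otimes> z [^] c)"
      unfolding zp' using cl by (simp add: m_assoc)
    also have "z [^] (- a) \<otimes> z [^] c = z [^] (c - a)"
      using cl int_pow_mult[of z "- a" c] by simp
    finally show ?thesis by (simp add: nf_def)
  qed
  show "y \<otimes> nf x y z a b c = nf x y z a (b + 1) (c - a)" by (rule main)
  have "y \<otimes> nf x y z a (b - 1) (c + a) = nf x y z a b c" unfolding main by simp
  moreover have "nf x y z a (b - 1) (c + a) \<in> carrier G" unfolding nf_def using cl by simp
  ultimately show "inv y \<otimes> nf x y z a b c = nf x y z a (b - 1) (c + a)"
    using cl by (metis inv_solve_left m_closed)
qed

end

end

section \<open>The Heisenberg group and its ascending HNN-extensions in coordinates\<close>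

definition HQ :: "vec monoid" where
  "HQ = \<lparr>carrier = UNIV, monoid.mult = hmul, monoid.one = (0, 0, 0)\<rparr>"

lemma HQ_simps [simp]:
  "carrier HQ = UNIV" "monoid.mult HQ = hmul" "\<one>\<^bsub>HQ\<^esub> = (0, 0, 0)"
  by (simp_all add: HQ_def)

lemma group_HQ: "group HQ"
proof (rule groupI)
  show "\<exists>y\<in>carrier HQ. y \<otimes>\<^bsub>HQ\<^esub> x = \<one>\<^bsub>HQ\<^esub>" for x
    by (rule bexI[of _ "hinv x"]) simp_all
qed (simp_all add: hmul_assoc)

interpretation HQ: group HQ by (rule group_HQ)

lemma HQ_inv [simp]: "inv\<^bsub>HQ\<^esub> v = hinv v"
  by (rule HQ.inv_equality) simp_all

text \<open>In exponential coordinates the bracket term of proportional vectors vanishes, so powers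
  are multiples.\<close>

lemma HQ_int_pow: "(a, b, c) [^]\<^bsub>HQ\<^esub> (i::int) = (of_int i * a, of_int i * b, of_int i * c)"
proof (induction i rule: int_induct[where k = 0])
  case (step1 i)
  have "(a, b, c) [^]\<^bsub>HQ\<^esub> (i + 1) = hmul ((a, b, c) [^]\<^bsub>HQ\<^esub> i) (a, b, c)"
    using HQ.int_pow_Suc(1)[of "(a, b, c)" i] by (simp only: HQ_simps UNIV_I)
  then show ?case unfolding step1 by (simp add: hmul.simps algebra_simps)
next
  case (step2 i)
  have "(a, b, c) [^]\<^bsub>HQ\<^esub> (i - 1) = hmul (hinv (a, b, c)) ((a, b, c) [^]\<^bsub>HQ\<^esub> i)"
    using HQ.int_pow_Suc(3)[of "(a, b, c)" i] by (simp only: HQ_simps HQ_inv UNIV_I)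
  then show ?case unfolding step2 by (simp add: hmul.simps hinv.simps algebra_simps)
qed simp

abbreviation "heis_S \<equiv> {Gen_x, Gen_y}"

definition heis_R :: "(heisenberg_gen gword \<times> heisenberg_gen gword) set" where
  "heis_R = (let x = [(Gen_x, True)]; y = [(Gen_y, True)]; z = gword_commutator x y
     in {(gword_commutator z x, []), (gword_commutator z y, [])})"

lemma heisenberg_eq: "heisenberg = presented_group heis_S heis_R"
  by (simp add: heisenberg_def heis_R_def Let_def)

interpretation heis: group heisenberg
  unfolding heisenberg_eq by (rule group_presented_group)

abbreviation "heis_x \<equiv> presented_gen heis_S heis_R Gen_x"
abbreviation "heis_y \<equiv> presented_gen heis_S heis_R Gen_y"

lemma heis_gen_closed: "heis_x \<in> carrier heisenberg" "heis_y \<in> carrier heisenberg"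
  unfolding heisenberg_eq by (simp_all add: presented_gen_closed)

definition heis_z where
  "heis_z = heis_x \<otimes>\<^bsub>heisenberg\<^esub> heis_y \<otimes>\<^bsub>heisenberg\<^esub> inv\<^bsub>heisenberg\<^esub> heis_x
    \<otimes>\<^bsub>heisenberg\<^esub> inv\<^bsub>heisenberg\<^esub> heis_y"

lemma (in group) commutator_eq_one:
  assumes "x \<in> carrier G" "y \<in> carrier G" "x \<otimes> y \<otimes> inv x \<otimes> inv y = \<one>"
  shows "x \<otimes> y = y \<otimes> x"
proof -
  have "x \<otimes> y = (x \<otimes> y \<otimes> inv x \<otimes> inv y) \<otimes> (y \<otimes> x)"
    using assms(1,2) by (simp add: m_assoc) (simp add: m_assoc[symmetric])
  then show ?thesis using assms by simp
qed

lemma heis_z_central: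
  "heis_z \<otimes>\<^bsub>heisenberg\<^esub> heis_x = heis_x \<otimes>\<^bsub>heisenberg\<^esub> heis_z"
  "heis_z \<otimes>\<^bsub>heisenberg\<^esub> heis_y = heis_y \<otimes>\<^bsub>heisenberg\<^esub> heis_z"
proof -
  let ?x = "[(Gen_x, True)]" and ?y = "[(Gen_y, True)]"
  let ?z = "gword_commutator ?x ?y"
  let ?ev = "gword_eval heisenberg (presented_gen heis_S heis_R)"
  have im: "presented_gen heis_S heis_R ` heis_S \<subseteq> carrier heisenberg"
    unfolding heisenberg_eq by (rule presented_gen_image)
  have w: "?x \<in> gwords heis_S" "?y \<in> gwords heis_S" "?z \<in> gwords heis_S"
    by (simp_all add: gword_commutator_def)
  have x: "?ev ?x = heis_x" and y: "?ev ?y = heis_y"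
    using heis_gen_closed by simp_all
  have z: "?ev ?z = heis_z"
    unfolding heis.gword_eval_commutator[OF im w(1,2)] x y heis_z_def ..
  have zc: "heis_z \<in> carrier heisenberg" unfolding heis_z_def using heis_gen_closed by simp
  have rel: "?ev r = \<one>\<^bsub>heisenberg\<^esub>" if "(r, []) \<in> heis_R" "r \<in> gwords heis_S" for r
    using presented_group_relation[OF that] unfolding heisenberg_eq by simp
  have "?ev (gword_commutator ?z ?x) = \<one>\<^bsub>heisenberg\<^esub>"
    by (rule rel) (simp_all add: heis_R_def Let_def gword_commutator_def)
  then show "heis_z \<otimes>\<^bsub>heisenberg\<^esub> heis_x = heis_x \<otimes>\<^bsub>heisenberg\<^esub> heis_z"
    by (intro heis.commutator_eq_one zc heis_gen_closed)
      (simp only: heis.gword_eval_commutator[OF im w(3,1)] x z)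
  have "?ev (gword_commutator ?z ?y) = \<one>\<^bsub>heisenberg\<^esub>"
    by (rule rel) (simp_all add: heis_R_def Let_def gword_commutator_def)
  then show "heis_z \<otimes>\<^bsub>heisenberg\<^esub> heis_y = heis_y \<otimes>\<^bsub>heisenberg\<^esub> heis_z"
    by (intro heis.commutator_eq_one zc heis_gen_closed)
      (simp only: heis.gword_eval_commutator[OF im w(3,2)] y z)
qed

abbreviation "heis_nf \<equiv> group.nf heisenberg heis_x heis_y heis_z"

lemmas heis_nf_def = heis.nf_def[of heis_x heis_y heis_z]

lemma heis_normal_form:
  assumes "g \<in> carrier heisenberg"
  obtains a b c where "g = heis_nf a b c"
proof -
  note nf_x = heis.nf_x[OF heis_gen_closed heis_z_def heis_z_central]
  note nf_y = heis.nf_y[OF heis_gen_closed heis_z_def heis_z_central]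
  have "\<exists>a b c. g = heis_nf a b c"
    using assms unfolding heisenberg_eq
  proof (induction rule: presented_group_induct)
    case one
    have "\<one>\<^bsub>heisenberg\<^esub> = heis_nf 0 0 0" by (simp add: heis_nf_def)
    then show ?case unfolding heisenberg_eq by blast
  next
    case (gen t g)
    then show ?case using nf_x(1) nf_y(1) unfolding heisenberg_eq by (cases t) metis+
  next
    case (inv t g)
    then show ?case using nf_x(2) nf_y(2) unfolding heisenberg_eq by (cases t) metis+
  qed
  then show thesis using that by blast
qed

definition heis_coords :: "heisenberg_gen gword set \<Rightarrow> vec" where
  "heis_coords = presented_hom HQ (case_heisenberg_gen (1, 0, 0) (0, 1, 0))"

lemma heis_HQ_relations:
  "(r, s) \<in> heis_R \<Longrightarrow> r \<in> gwords heis_S \<Longrightarrow> s \<in> gwords heis_S \<Longrightarrow>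
    gword_eval HQ (case_heisenberg_gen (1, 0, 0) (0, 1, 0)) r
    = gword_eval HQ (case_heisenberg_gen (1, 0, 0) (0, 1, 0)) s"
  by (auto simp: heis_R_def Let_def gword_commutator_def hmul.simps hinv.simps)

lemma heis_coords_hom: "heis_coords \<in> hom heisenberg HQ"
  unfolding heis_coords_def heisenberg_eq by (rule HQ.presented_hom_hom[OF _ heis_HQ_relations]) simp_all

interpretation heis_coords: group_hom heisenberg HQ heis_coords
  using heis_coords_hom by (simp add: group_hom_def group_hom_axioms_def heis.is_group group_HQ)

lemma heis_coords_gen: "heis_coords heis_x = (1, 0, 0)" "heis_coords heis_y = (0, 1, 0)"
  unfolding heis_coords_def
  by (subst presented_hom_gen[OF group_HQ _ heis_HQ_relations]; simp)+

lemma heis_coords_nf: "heis_coords (heis_nf a b c) = (of_int a, of_int b, of_int (a * b + 2 * c))"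
proof -
  have zc: "heis_z \<in> carrier heisenberg" unfolding heis_z_def using heis_gen_closed by simp
  have z: "heis_coords heis_z = (0, 0, 2)"
    unfolding heis_z_def using heis_gen_closed by (simp add: heis_coords_gen hmul.simps hinv.simps)
  have p: "heis_coords (g [^]\<^bsub>heisenberg\<^esub> (i::int)) = heis_coords g [^]\<^bsub>HQ\<^esub> i"
    if "g \<in> carrier heisenberg" for g i
    using that by (rule heis_coords.hom_int_pow)
  show ?thesis
    using heis_gen_closed zc by (simp add: heis_nf_def p z heis_coords_gen HQ_int_pow hmul.simps)
qed

text \<open>The coordinates of a normal form determine its three exponents, so the presented group
  is no larger than its image.\<close>

lemma heis_coords_inj: "inj_on heis_coords (carrier heisenberg)"
proof (rule inj_onI)
  fix g h assume "g \<in> carrier heisenberg" "h \<in> carrier heisenberg" "heis_coords g = heis_coords h"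
  moreover from this obtain a b c a' b' c' where "g = heis_nf a b c" "h = heis_nf a' b' c'"
    using heis_normal_form by metis
  ultimately show "g = h" by (simp only: heis_coords_nf prod.inject of_int_eq_iff) auto
qed

lemma heis_coords_image: "heis_coords ` carrier heisenberg = heis_lattice"
proof (intro equalityI subsetI)
  fix v assume "v \<in> heis_coords ` carrier heisenberg"
  then obtain a b c where "v = (of_int a, of_int b, of_int (a * b + 2 * c))"
    using heis_normal_form heis_coords_nf by (metis imageE)
  then show "v \<in> heis_lattice" using heis_latticeI[of "a * b + 2 * c" a b] by simp
next
  fix v assume "v \<in> heis_lattice"
  then obtain a b c where v: "v = (of_int a, of_int b, of_int c)" "even (c - a * b)"
    by (rule heis_latticeE)
  then have "v = heis_coords (heis_nf a b ((c - a * b) div 2))" unfolding heis_coords_nf by simp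
  moreover have "heis_nf a b ((c - a * b) div 2) \<in> carrier heisenberg"
    unfolding heis_nf_def using heis_gen_closed by (simp add: heis_z_def)
  ultimately show "v \<in> heis_coords ` carrier heisenberg" by blast
qed

text \<open>The images of x and y supply the columns of the matrix; two homomorphisms on a presented
  group that agree on generators are equal.\<close>

lemma heis_endomorphism:
  assumes \<theta>: "\<theta> \<in> hom heisenberg heisenberg" "inj_on \<theta> (carrier heisenberg)"
  obtains p q r s l k where "heis_model p q r s l k"
    "\<And>g. g \<in> carrier heisenberg \<Longrightarrow> heis_coords (\<theta> g) = heis_model.\<phi> p q r s l k (heis_coords g)"
proof -
  have cl: "\<theta> g \<in> carrier heisenberg" if "g \<in> carrier heisenberg" for g
    using \<theta>(1) that by (rule hom_in_carrier)
  have "heis_coords (\<theta> heis_x) \<in> heis_lattice" "heis_coords (\<theta> heis_y) \<in> heis_lattice"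
    using cl heis_gen_closed heis_coords_image by auto
  then obtain p r l q s k where x: "heis_coords (\<theta> heis_x) = (of_int p, of_int r, of_int l)"
    and y: "heis_coords (\<theta> heis_y) = (of_int q, of_int s, of_int k)"
    by (metis heis_latticeE)
  define f where "f = hlin (of_int p) (of_int q) (of_int r) (of_int s) (of_int l) (of_int k)"
  have f_hom: "f \<in> hom HQ HQ" by (rule homI) (simp_all add: f_def hlin_hmul)
  have eq: "heis_coords (\<theta> g) = f (heis_coords g)" if g: "g \<in> carrier heisenberg" for g
  proof -
    have "(heis_coords \<circ> \<theta>) g = (f \<circ> heis_coords) g"
    proof (rule presented_group_hom_eqI[OF group_HQ])
      show "heis_coords \<circ> \<theta> \<in> hom (presented_group heis_S heis_R) HQ"
        "f \<circ> heis_coords \<in> hom (presented_group heis_S heis_R) HQ"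
        using hom_compose[OF \<theta>(1) heis_coords_hom] hom_compose[OF heis_coords_hom f_hom]
        unfolding heisenberg_eq .
      show "g \<in> carrier (presented_group heis_S heis_R)" using g unfolding heisenberg_eq .
      fix t assume "t \<in> heis_S"
      then show "(heis_coords \<circ> \<theta>) (presented_gen heis_S heis_R t) = (f \<circ> heis_coords) (presented_gen heis_S heis_R t)"
        by (auto simp: x y heis_coords_gen f_def hlin.simps)
    qed
    then show ?thesis by simp
  qed
  \<comment> \<open>With determinant 0 the endomorphism would kill z, whose coordinates are (0, 0,
    2), against injectivity.\<close>
  have "p * s - q * r \<noteq> 0"
  proof
    assume "p * s - q * r = 0"
    then have "rat_of_int p * of_int s - of_int q * of_int r = 0" by (simp flip: of_int_mult of_int_diff)
    then have "f (0, 0, 2) = (0, 0, 0)" by (simp add: f_def hlin.simps)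
    moreover have "heis_coords (heis_nf 0 0 1) = (0, 0, 2)" unfolding heis_coords_nf by simp
    moreover have z: "heis_nf 0 0 1 \<in> carrier heisenberg"
      unfolding heis_nf_def using heis_gen_closed by (simp add: heis_z_def)
    ultimately have "heis_coords (\<theta> (heis_nf 0 0 1)) = heis_coords (\<theta> \<one>\<^bsub>heisenberg\<^esub>)"
      using eq hom_one[OF \<theta>(1)] heis.is_group by simp
    then have "heis_nf 0 0 1 = \<one>\<^bsub>heisenberg\<^esub>"
      using heis_coords_inj \<theta>(2) cl z by (meson heis.one_closed inj_onD)
    then show False using \<open>heis_coords (heis_nf 0 0 1) = (0, 0, 2)\<close> by simp
  qed
  moreover have "f v \<in> heis_lattice" if v: "v \<in> heis_lattice" for v
  proof -
    obtain g where g: "g \<in> carrier heisenberg" "v = heis_coords g"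
      using v heis_coords_image by (metis imageE)
    then show ?thesis using eq[OF g(1)] cl[OF g(1)] heis_coords_image by (metis imageI)
  qed
  ultimately have model: "heis_model p q r s l k"
    unfolding f_def by (intro heis_model.intro)
  show thesis
    by (rule that[OF model]) (simp only: eq heis_model.\<phi>_def[OF model] f_def)
qed

section \<open>Ascending HNN-extensions as semidirect products\<close>

context heis_model
begin

context
  fixes N :: "('c, 'd) monoid_scheme" and \<theta> :: "'c \<Rightarrow> 'c" and \<nu> :: "'c \<Rightarrow> vec"
  assumes N: "group N" and \<theta>: "\<theta> \<in> hom N N" and \<nu>: "\<nu> \<in> hom N HQ"
    and \<nu>_inj: "inj_on \<nu> (carrier N)" and \<nu>_image: "\<nu> ` carrier N = heis_lattice"
    and \<nu>_\<theta>: "g \<in> carrier N \<Longrightarrow> \<nu> (\<theta> g) = \<phi> (\<nu> g)"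
begin

interpretation N: group N by (rule N)

definition hnn_S :: "'c option set" where "hnn_S = insert None (Some ` carrier N)"

lemma hnn_S_iff [simp]: "None \<in> hnn_S" "Some g \<in> hnn_S \<longleftrightarrow> g \<in> carrier N"
  by (auto simp: hnn_S_def)

definition hnn_R where
  "hnn_R = {([(Some g, True), (Some h, True)], [(Some (g \<otimes>\<^bsub>N\<^esub> h), True)]) | g h.
          g \<in> carrier N \<and> h \<in> carrier N}
       \<union> {([(None, True), (Some g, True), (None, False)], [(Some (\<theta> g), True)]) | g.
          g \<in> carrier N}"

lemma hnn_eq: "hnn_group N \<theta> = presented_group hnn_S hnn_R"
  by (simp add: hnn_group_def hnn_S_def hnn_R_def)

interpretation E: group "hnn_group N \<theta>"
  unfolding hnn_eq by (rule group_presented_group)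

definition \<tau> where "\<tau> = presented_gen hnn_S hnn_R None"
definition \<iota> where "\<iota> g = presented_gen hnn_S hnn_R (Some g)"

lemma hnn_gen_closed [simp]:
  "\<tau> \<in> carrier (hnn_group N \<theta>)" "g \<in> carrier N \<Longrightarrow> \<iota> g \<in> carrier (hnn_group N \<theta>)"
  unfolding hnn_eq \<tau>_def \<iota>_def by (simp_all add: presented_gen_closed)

lemma \<theta>_closed [simp]: "g \<in> carrier N \<Longrightarrow> \<theta> g \<in> carrier N"
  using \<theta> by (rule hom_in_carrier)

lemma \<iota>_mult:
  assumes "g \<in> carrier N" "h \<in> carrier N"
  shows "\<iota> g \<otimes>\<^bsub>hnn_group N \<theta>\<^esub> \<iota> h = \<iota> (g \<otimes>\<^bsub>N\<^esub> h)"
proof -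
  have "([(Some g, True), (Some h, True)], [(Some (g \<otimes>\<^bsub>N\<^esub> h), True)]) \<in> hnn_R"
    using assms unfolding hnn_R_def by blast
  from presented_group_relation[OF this, of hnn_S] assms show ?thesis
    unfolding hnn_eq[symmetric] by (simp flip: \<iota>_def)
qed

lemma \<tau>_conj:
  assumes "g \<in> carrier N"
  shows "\<tau> \<otimes>\<^bsub>hnn_group N \<theta>\<^esub> \<iota> g = \<iota> (\<theta> g) \<otimes>\<^bsub>hnn_group N \<theta>\<^esub> \<tau>"
proof -
  have "([(None, True), (Some g, True), (None, False)], [(Some (\<theta> g), True)]) \<in> hnn_R"
    using assms unfolding hnn_R_def by blast
  from presented_group_relation[OF this, of hnn_S] assms
  have "\<tau> \<otimes>\<^bsub>hnn_group N \<theta>\<^esub> (\<iota> g \<otimes>\<^bsub>hnn_group N \<theta>\<^esub> inv\<^bsub>hnn_group N \<theta>\<^esub> \<tau>) = \<iota> (\<theta> g)"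
    unfolding hnn_eq[symmetric] by (simp flip: \<iota>_def \<tau>_def)
  then have "\<iota> (\<theta> g) \<otimes>\<^bsub>hnn_group N \<theta>\<^esub> \<tau> =
    \<tau> \<otimes>\<^bsub>hnn_group N \<theta>\<^esub> (\<iota> g \<otimes>\<^bsub>hnn_group N \<theta>\<^esub> inv\<^bsub>hnn_group N \<theta>\<^esub> \<tau>) \<otimes>\<^bsub>hnn_group N \<theta>\<^esub> \<tau>"
    by simp
  then show ?thesis using assms by (simp add: E.m_assoc)
qed

lemma \<iota>_hom: "\<iota> \<in> hom N (hnn_group N \<theta>)"
  by (rule homI) (simp_all add: \<iota>_mult)

interpretation \<iota>: group_hom N "hnn_group N \<theta>" \<iota>
  using \<iota>_hom by (simp add: group_hom_def group_hom_axioms_def N E.is_group)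

lemma \<theta>_pow_closed [simp]: "g \<in> carrier N \<Longrightarrow> (\<theta> ^^ i) g \<in> carrier N"
  by (induction i) simp_all

lemma \<tau>_pow_conj:
  assumes "g \<in> carrier N"
  shows "\<tau> [^]\<^bsub>hnn_group N \<theta>\<^esub> (i::nat) \<otimes>\<^bsub>hnn_group N \<theta>\<^esub> \<iota> g =
    \<iota> ((\<theta> ^^ i) g) \<otimes>\<^bsub>hnn_group N \<theta>\<^esub> \<tau> [^]\<^bsub>hnn_group N \<theta>\<^esub> i"
  using assms
proof (induction i arbitrary: g)
  case (Suc i)
  have "\<tau> [^]\<^bsub>hnn_group N \<theta>\<^esub> Suc i \<otimes>\<^bsub>hnn_group N \<theta>\<^esub> \<iota> g = \<tau> [^]\<^bsub>hnn_group N \<theta>\<^esub> i \<otimes>\<^bsub>hnn_group N \<theta>\<^esub> (\<tau> \<otimes>\<^bsub>hnn_group N \<theta>\<^esub> \<iota> g)"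
    using Suc.prems by (simp add: E.m_assoc)
  also have "\<dots> = (\<tau> [^]\<^bsub>hnn_group N \<theta>\<^esub> i \<otimes>\<^bsub>hnn_group N \<theta>\<^esub> \<iota> (\<theta> g)) \<otimes>\<^bsub>hnn_group N \<theta>\<^esub> \<tau>"
    unfolding \<tau>_conj[OF Suc.prems] using Suc.prems by (simp add: E.m_assoc)
  also have "\<dots> = \<iota> ((\<theta> ^^ i) (\<theta> g)) \<otimes>\<^bsub>hnn_group N \<theta>\<^esub> \<tau> [^]\<^bsub>hnn_group N \<theta>\<^esub> i \<otimes>\<^bsub>hnn_group N \<theta>\<^esub> \<tau>"
    unfolding Suc.IH[OF \<theta>_closed[OF Suc.prems]] ..
  finally show ?case using Suc.prems by (simp add: E.m_assoc funpow_swap1)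
qed simp

text \<open>Base elements pass \<open>\<tau>\<close> to its left and the inverse of
  \<open>\<tau>\<close> to its right, in both cases changed by \<open>\<theta>\<close>. So negative
  powers collect on the left and positive ones on the right, even if \<open>\<theta>\<close> is not
  surjective.\<close>

definition hnf where
  "hnf i g j = inv\<^bsub>hnn_group N \<theta>\<^esub> (\<tau> [^]\<^bsub>hnn_group N \<theta>\<^esub> (i::nat)) \<otimes>\<^bsub>hnn_group N \<theta>\<^esub>
    (\<iota> g \<otimes>\<^bsub>hnn_group N \<theta>\<^esub> \<tau> [^]\<^bsub>hnn_group N \<theta>\<^esub> (j::nat))"

lemma hnf_closed: "g \<in> carrier N \<Longrightarrow> hnf i g j \<in> carrier (hnn_group N \<theta>)"
  by (simp add: hnf_def)

lemma hnf_\<iota>: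
  assumes "g \<in> carrier N" "h \<in> carrier N"
  shows "\<iota> h \<otimes>\<^bsub>hnn_group N \<theta>\<^esub> hnf i g j = hnf i ((\<theta> ^^ i) h \<otimes>\<^bsub>N\<^esub> g) j"
proof -
  let ?t = "\<tau> [^]\<^bsub>hnn_group N \<theta>\<^esub> i"
  have "?t \<otimes>\<^bsub>hnn_group N \<theta>\<^esub> (\<iota> h \<otimes>\<^bsub>hnn_group N \<theta>\<^esub> hnf i g j)
    = (?t \<otimes>\<^bsub>hnn_group N \<theta>\<^esub> \<iota> h) \<otimes>\<^bsub>hnn_group N \<theta>\<^esub> hnf i g j"
    using assms by (simp add: E.m_assoc hnf_closed)
  also have "\<dots> = \<iota> ((\<theta> ^^ i) h) \<otimes>\<^bsub>hnn_group N \<theta>\<^esub> (?t \<otimes>\<^bsub>hnn_group N \<theta>\<^esub> hnf i g j)"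
    unfolding \<tau>_pow_conj[OF assms(2)] using assms by (simp add: E.m_assoc hnf_closed)
  also have "?t \<otimes>\<^bsub>hnn_group N \<theta>\<^esub> hnf i g j = \<iota> g \<otimes>\<^bsub>hnn_group N \<theta>\<^esub> \<tau> [^]\<^bsub>hnn_group N \<theta>\<^esub> j"
    unfolding hnf_def using assms by (simp add: E.m_assoc[symmetric])
  also have "\<iota> ((\<theta> ^^ i) h) \<otimes>\<^bsub>hnn_group N \<theta>\<^esub> \<dots> = \<iota> ((\<theta> ^^ i) h \<otimes>\<^bsub>N\<^esub> g) \<otimes>\<^bsub>hnn_group N \<theta>\<^esub> \<tau> [^]\<^bsub>hnn_group N \<theta>\<^esub> j"
    using assms by (simp add: \<iota>_mult[symmetric] E.m_assoc del: \<iota>.hom_mult)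
  also have "\<dots> = ?t \<otimes>\<^bsub>hnn_group N \<theta>\<^esub> hnf i ((\<theta> ^^ i) h \<otimes>\<^bsub>N\<^esub> g) j"
    unfolding hnf_def using assms by (simp add: E.m_assoc[symmetric] del: \<iota>.hom_mult)
  finally show ?thesis using assms by (simp add: hnf_closed del: \<iota>.hom_mult)
qed

lemma hnf_inv_\<tau>:
  "g \<in> carrier N \<Longrightarrow> inv\<^bsub>hnn_group N \<theta>\<^esub> \<tau> \<otimes>\<^bsub>hnn_group N \<theta>\<^esub> hnf i g j = hnf (Suc i) g j"
  by (simp add: hnf_def E.inv_mult_group E.m_assoc)

text \<open>The exponent on the left is a natural number: \<open>\<tau>\<close> either cancels there
  or, when that exponent is 0, is pushed through \<open>g\<close>.\<close>

lemma hnf_\<tau>: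
  assumes "g \<in> carrier N"
  shows "\<tau> \<otimes>\<^bsub>hnn_group N \<theta>\<^esub> hnf (Suc i) g j = hnf i g j"
    "\<tau> \<otimes>\<^bsub>hnn_group N \<theta>\<^esub> hnf 0 g j = hnf 0 (\<theta> g) (Suc j)"
proof -
  show "\<tau> \<otimes>\<^bsub>hnn_group N \<theta>\<^esub> hnf (Suc i) g j = hnf i g j"
    unfolding hnf_inv_\<tau>[OF assms, symmetric] using assms
    by (simp add: hnf_closed E.m_assoc[symmetric])
  have "\<tau> \<otimes>\<^bsub>hnn_group N \<theta>\<^esub> hnf 0 g j
    = (\<tau> \<otimes>\<^bsub>hnn_group N \<theta>\<^esub> \<iota> g) \<otimes>\<^bsub>hnn_group N \<theta>\<^esub> \<tau> [^]\<^bsub>hnn_group N \<theta>\<^esub> j"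
    using assms by (simp add: hnf_def E.m_assoc)
  then show "\<tau> \<otimes>\<^bsub>hnn_group N \<theta>\<^esub> hnf 0 g j = hnf 0 (\<theta> g) (Suc j)"
    unfolding \<tau>_conj[OF assms] using assms
    by (simp add: hnf_def E.m_assoc E.nat_pow_Suc2 del: E.nat_pow_Suc nat_pow_Suc)
qed

lemma hnn_normal_form:
  assumes "e \<in> carrier (hnn_group N \<theta>)"
  shows "\<exists>i j. \<exists>g\<in>carrier N. e = hnf i g j"
  using assms unfolding hnn_eq
proof (induction rule: presented_group_induct)
  case one
  have "\<one>\<^bsub>hnn_group N \<theta>\<^esub> = hnf 0 \<one>\<^bsub>N\<^esub> 0" by (simp add: hnf_def)
  then show ?case unfolding hnn_eq using N.one_closed by blast
next
  case (gen t e)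
  then obtain i j g where g: "g \<in> carrier N" "e = hnf i g j" by blast
  show ?case
  proof (cases t)
    case None
    then show ?thesis using hnf_\<tau>[OF g(1)] g unfolding \<tau>_def hnn_eq by (cases i) (metis \<theta>_closed)+
  next
    case (Some h)
    then have "h \<in> carrier N" using gen by simp
    then show ?thesis using hnf_\<iota>[OF g(1)] g unfolding Some \<iota>_def hnn_eq
      by (metis N.m_closed \<theta>_pow_closed)
  qed
next
  case (inv t e)
  then obtain i j g where g: "g \<in> carrier N" "e = hnf i g j" by blast
  show ?case
  proof (cases t)
    case None
    then show ?thesis using hnf_inv_\<tau>[OF g(1)] g unfolding \<tau>_def hnn_eq by metis
  next
    case (Some h)
    then have h: "h \<in> carrier N" using inv by simp
    have "inv\<^bsub>hnn_group N \<theta>\<^esub> (\<iota> h) \<otimes>\<^bsub>hnn_group N \<theta>\<^esub> e = hnf i ((\<theta> ^^ i) (inv\<^bsub>N\<^esub> h) \<otimes>\<^bsub>N\<^esub> g) j"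
      using hnf_\<iota>[OF g(1), of "inv\<^bsub>N\<^esub> h"] g h by simp
    then show ?thesis unfolding Some \<iota>_def hnn_eq
      using g(1) h by (metis N.inv_closed N.m_closed \<theta>_pow_closed)
  qed
qed

section \<open>The isomorphism onto the semidirect product\<close>

definition \<gamma> :: "'c option \<Rightarrow> vec \<times> int" where
  "\<gamma> t = (case t of None \<Rightarrow> ((0, 0, 0), 1) | Some g \<Rightarrow> (\<nu> g, 0))"

lemma \<nu>_Ninf [simp]: "g \<in> carrier N \<Longrightarrow> \<nu> g \<in> Ninf"
  using \<nu>_image lattice_Ninf by blast

lemma \<nu>_mult: "g \<in> carrier N \<Longrightarrow> h \<in> carrier N \<Longrightarrow> \<nu> (g \<otimes>\<^bsub>N\<^esub> h) = hmul (\<nu> g) (\<nu> h)"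
  using \<nu> by (simp add: hom_def)

lemma \<gamma>_image: "\<gamma> ` hnn_S \<subseteq> carrier Gc"
  by (auto simp: \<gamma>_def hnn_S_def simp del: split_paired_All)

lemma \<gamma>_relations:
  assumes "(u, v) \<in> hnn_R"
  shows "gword_eval Gc \<gamma> u = gword_eval Gc \<gamma> v"
proof -
  have inv1: "inv\<^bsub>Gc\<^esub> ((0, 0, 0), 1) = ((0, 0, 0), - 1)"
    by (simp add: Gc_inv hinv.simps)
  consider g h where "g \<in> carrier N" "h \<in> carrier N" "u = [(Some g, True), (Some h, True)]"
      "v = [(Some (g \<otimes>\<^bsub>N\<^esub> h), True)]"
    | g where "g \<in> carrier N" "u = [(None, True), (Some g, True), (None, False)]"
      "v = [(Some (\<theta> g), True)]"
    using assms unfolding hnn_R_def by blast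
  then show ?thesis
    by cases (simp_all add: \<gamma>_def \<nu>_mult \<nu>_\<theta> inv1)
qed

definition \<Psi> where "\<Psi> = presented_hom Gc \<gamma>"

lemma \<Psi>_hom: "\<Psi> \<in> hom (hnn_group N \<theta>) Gc"
  unfolding \<Psi>_def hnn_eq by (rule Gc.presented_hom_hom[OF \<gamma>_image \<gamma>_relations])

lemma \<Psi>_gen: "\<Psi> \<tau> = ((0, 0, 0), 1)" "g \<in> carrier N \<Longrightarrow> \<Psi> (\<iota> g) = (\<nu> g, 0)"
  unfolding \<Psi>_def \<tau>_def \<iota>_def
  by (subst presented_hom_gen[OF group_Gc \<gamma>_image \<gamma>_relations]; simp add: \<gamma>_def)+

interpretation \<Psi>: group_hom "hnn_group N \<theta>" Gc \<Psi>
  using \<Psi>_hom by (simp add: group_hom_def group_hom_axioms_def group_Gc E.is_group)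

lemma \<Psi>_hnf:
  assumes "g \<in> carrier N"
  shows "\<Psi> (hnf i g j) = (zpow \<phi> (- int i) (\<nu> g), int j - int i)"
proof -
  have pow: "((0, 0, 0), 1) [^]\<^bsub>Gc\<^esub> (n::nat) = ((0, 0, 0), int n)" for n
  proof (induction n)
    case (Suc n)
    then show ?case using zpow_zero[of "int n"] by simp
  qed simp
  have "inv\<^bsub>Gc\<^esub> ((0, 0, 0), int i) = ((0, 0, 0), - int i)"
    by (simp add: Gc_inv hinv.simps)
  then show ?thesis using assms
    by (simp add: hnf_def \<Psi>_gen \<Psi>.hom_nat_pow pow del: Gc_simps(1))
qed

text \<open>Everything is read off from normal forms: in the kernel the two exponents agree and
  \<open>g\<close> is trivial, so the form collapses.\<close>

lemma \<Psi>_iso: "\<Psi> \<in> iso (hnn_group N \<theta>) Gc"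
proof -
  have "inj_on \<Psi> (carrier (hnn_group N \<theta>))"
  proof (rule \<Psi>.trivial_ker_imp_inj, intro equalityI subsetI)
    fix e assume "e \<in> kernel (hnn_group N \<theta>) Gc \<Psi>"
    then have e: "e \<in> carrier (hnn_group N \<theta>)" "\<Psi> e = ((0, 0, 0), 0)" by (simp_all add: kernel_def)
    then obtain i j g where g: "g \<in> carrier N" "e = hnf i g j" using hnn_normal_form by blast
    then have 0: "zpow \<phi> (- int i) (\<nu> g) = (0, 0, 0)" and ij: "i = j" using e(2) \<Psi>_hnf by simp_all
    have "\<nu> g = zpow \<phi> (int i) (zpow \<phi> (- int i) (\<nu> g))" by (simp only: zpow_\<phi>_cancel)
    then have "\<nu> g = (0, 0, 0)" unfolding 0 zpow_zero .
    moreover have "\<nu> \<one>\<^bsub>N\<^esub> = (0, 0, 0)" using hom_one[OF \<nu> N group_HQ] by simp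
    ultimately have "g = \<one>\<^bsub>N\<^esub>" using \<nu>_inj g(1) by (metis N.one_closed inj_onD)
    then show "e \<in> {\<one>\<^bsub>hnn_group N \<theta>\<^esub>}" using g(2) ij by (simp add: hnf_def)
  qed (simp add: kernel_def)
  moreover have "\<Psi> ` carrier (hnn_group N \<theta>) = carrier Gc"
  proof (intro equalityI subsetI)
    fix u assume "u \<in> carrier Gc"
    then obtain v k where u: "u = (v, k)" "v \<in> Ninf" by (metis Gc_simps(1) SigmaE)
    then obtain i0 where i0: "(\<phi> ^^ i0) v \<in> heis_lattice" unfolding Ninf_def by blast
    \<comment> \<open>The summand from \<open>k\<close> keeps \<open>i + k\<close>, the exponent on
      the right of the normal form, nonnegative.\<close>
    define i where "i = i0 + nat \<bar>k\<bar>"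
    have "(\<phi> ^^ i) v \<in> heis_lattice" by (rule funpow_lattice_mono[OF i0]) (simp add: i_def)
    then obtain g where g: "g \<in> carrier N" "\<nu> g = (\<phi> ^^ i) v" using \<nu>_image by (metis imageE)
    have "zpow \<phi> (- int i) (\<nu> g) = v" unfolding g(2) zpow_of_nat[symmetric] by (simp only: zpow_\<phi>_cancel)
    moreover have "int i + k \<ge> 0" unfolding i_def by linarith
    then have "int (nat (int i + k)) - int i = k" by simp
    ultimately have "\<Psi> (hnf i g (nat (int i + k))) = u" unfolding \<Psi>_hnf[OF g(1)] u by simp
    then show "u \<in> \<Psi> ` carrier (hnn_group N \<theta>)" using hnf_closed[OF g(1)] by blast
  qed (use \<Psi>.hom_closed in blast)
  ultimately show ?thesis using \<Psi>_hom by (simp add: iso_def bij_betw_def)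
qed

lemma hnn_group_iso_Gc: "hnn_group N \<theta> \<cong> Gc"
  using \<Psi>_iso by (auto simp: is_iso_def)

end

end

theorem theorem1p4:
  fixes G :: "('a, 'b) monoid_scheme"
  assumes "ascending_HNN_extension heisenberg G"
  shows "transitive_self_similar G"
proof -
  obtain \<theta> where G: "group G" and \<theta>: "\<theta> \<in> hom heisenberg heisenberg" "inj_on \<theta> (carrier heisenberg)"
    and iso: "G \<cong> hnn_group heisenberg \<theta>"
    using assms unfolding ascending_HNN_extension_def by blast
  obtain p q r s l k where model: "heis_model p q r s l k"
    and eq: "\<And>g. g \<in> carrier heisenberg \<Longrightarrow>
      heis_coords (\<theta> g) = heis_model.\<phi> p q r s l k (heis_coords g)"
    using heis_endomorphism[OF \<theta>] by blast
  interpret heis_model p q r s l k by (rule model)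
  have "hnn_group heisenberg \<theta> \<cong> Gc"
    by (rule hnn_group_iso_Gc[where \<theta> = \<theta> and \<nu> = heis_coords, OF heis.is_group \<theta>(1) heis_coords_hom heis_coords_inj heis_coords_image eq])
  then have "G \<cong> Gc" using iso iso_trans by blast
  then obtain h where "h \<in> iso G Gc" unfolding is_iso_def by blast
  then show ?thesis using transitive_self_similar_iso[OF G] transitive_self_similar_model by blast
qed

end
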